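(* Let $X$ be a nontrivial complex uniformly convex Banach space and let $K$ be a compact Hausdorff space. Let $A(K,X)$ be an $X$-valued function space over a uniform algebra, with base algebra $A$, let $\Gamma$ be the Shilov boundary of $A$, and let $f\in S_{A(K,X)}$ (i.e. $f\in A(K,X)$ with $\|f\|=1$). Consider the statements: (i) $f$ is a Daugavet point (of $A(K,X)$); (ii) $f$ is a $\Delta$-point (of $A(K,X)$); (iii) there is a limit point $t_0$ of $\Gamma$ such that $\|f\|=\|f(t_0)\|_X$. Then (i) $\Rightarrow$ (ii) $\Rightarrow$ (iii). Moreover, if in addition $A\otimes X\subset A(K,X)$, then (i), (ii) and (iii) are equivalent.
   Context: A uniform algebra on a compact Hausdorff space $K$ is a closed subalgebra of $C(K)$ (complex-valued, supremum norm) that separates the points of $K$ and contains the constant functions. $C(K,X)$ is the Banach space of norm-continuous functions $K\to X$ with $\|f\|=\sup_{t\in K}\|f(t)\|_X$. A closed subspace $A(K,X)$ of $C(K,X)$ is an $X$-valued function space over a uniform algebra if (i) the base algebra $A:=\{x^*\circ f: f\in A(K,X),\ x^*\in X^*\}$ is a uniform algebra on $K$; and (ii) $\phi f\in A(K,X)$ for all $\phi\in A$, $f\in A(K,X)$, where $(\phi f)(t)=\phi(t)f(t)$. $A\otimes X$ is the set of functions $\phi\otimes x$ ($\phi\in A$, $x\in X$), $(\phi\otimes x)(t)=\phi(t)x$. A boundary for $A$ is a set $S\subset K$ such that for every $\phi\in A$ there is $t\in S$ with $|\phi(t)|=\|\phi\|_\infty$. The Shilov boundary $\Gamma$ of $A$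 is the smallest closed boundary of $A$. For a Banach space $Z$ with closed unit ball $B_Z$ and unit sphere $S_Z$, $z\in S_Z$ and $\epsilon>0$, let $\Delta_\epsilon(z)=\{y\in B_Z:\|z-y\|\ge 2-\epsilon\}$. A point $z\in S_Z$ is a $\Delta$-point if $z\in\overline{\mathrm{conv}}\,\Delta_\epsilon(z)$ for every $\epsilon>0$, and a Daugavet point if $B_Z=\overline{\mathrm{conv}}\,\Delta_\epsilon(z)$ for every $\epsilon>0$. $X$ is uniformly convex if $\delta_X(\epsilon)=\inf\{1-\|\frac{x+y}{2}\|: x,y\in B_X,\ \|x-y\|\ge\epsilon\}>0$ for each $0<\epsilon<2$. *)

theory Defs
  imports "HOL-Analysis.Analysis"
begin

section \<open>Complex normed spaces\<close>

text \<open>A complex normed space is a real normed space with a compatible complex scalar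
  multiplication, so that \<^const>\<open>closure\<close>, \<^const>\<open>hull\<close>, \<^const>\<open>norm\<close> etc. apply to it unchanged.\<close>

class complex_normed_vector = real_normed_vector +
  fixes scaleC :: "complex \<Rightarrow> 'a \<Rightarrow> 'a"  (infixr \<open>*\<^sub>C\<close> 75)
  assumes scaleC_add_right: "c *\<^sub>C (x + y) = c *\<^sub>C x + c *\<^sub>C y"
    and scaleC_add_left: "(c + d) *\<^sub>C x = c *\<^sub>C x + d *\<^sub>C x"
    and scaleC_scaleC: "c *\<^sub>C d *\<^sub>C x = (c * d) *\<^sub>C x"
    and scaleC_of_real: "complex_of_real r *\<^sub>C x = r *\<^sub>R x"
    and norm_scaleC: "norm (c *\<^sub>C x) = cmod c * norm x"

class complex_banach = complex_normed_vector + banach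

lemma bounded_bilinear_scaleC:
  "bounded_bilinear (scaleC :: complex \<Rightarrow> 'a \<Rightarrow> 'a::complex_normed_vector)"
proof
  fix c d :: complex and x y :: 'a and r :: real
  show "(c + d) *\<^sub>C x = c *\<^sub>C x + d *\<^sub>C x" by (rule scaleC_add_left)
  show "c *\<^sub>C (x + y) = c *\<^sub>C x + c *\<^sub>C y" by (rule scaleC_add_right)
  show "(r *\<^sub>R c) *\<^sub>C x = r *\<^sub>R c *\<^sub>C x"
    by (simp add: scaleC_of_real[symmetric] scaleC_scaleC scaleR_conv_of_real)
  show "c *\<^sub>C r *\<^sub>R x = r *\<^sub>R c *\<^sub>C x"
    by (simp add: scaleC_of_real[symmetric] scaleC_scaleC mult.commute)
  show "\<exists>K. \<forall>c (x::'a). norm (c *\<^sub>C x) \<le> norm c * norm x * K"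
    by (rule exI[of _ 1]) (simp add: norm_scaleC)
qed

lemmas continuous_on_scaleC [continuous_intros] =
  bounded_bilinear.continuous_on[OF bounded_bilinear_scaleC]

instantiation complex :: complex_banach
begin

definition scaleC_complex :: "complex \<Rightarrow> complex \<Rightarrow> complex" where
  "scaleC_complex c z = c * z"

instance
  by standard (simp_all add: scaleC_complex_def algebra_simps norm_mult scaleR_conv_of_real)

end

definition csubspace :: "'a::complex_normed_vector set \<Rightarrow> bool" where
  "csubspace S \<longleftrightarrow> 0 \<in> S \<and> (\<forall>x\<in>S. \<forall>y\<in>S. x + y \<in> S) \<and> (\<forall>c. \<forall>x\<in>S. c *\<^sub>C x \<in> S)"

definition cdual :: "('a::complex_normed_vector \<Rightarrow> complex) set" where
  "cdual = {l. bounded_linear l \<and> (\<forall>c x. l (c *\<^sub>C x) = c * l x)}"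

definition modulus_of_convexity :: "'a::real_normed_vector itself \<Rightarrow> real \<Rightarrow> real" where
  "modulus_of_convexity _ \<epsilon> =
     Inf {1 - norm ((1/2) *\<^sub>R (x + y)) | x y :: 'a. norm x \<le> 1 \<and> norm y \<le> 1 \<and> norm (x - y) \<ge> \<epsilon>}"

definition uniformly_convex :: "'a::real_normed_vector itself \<Rightarrow> bool" where
  "uniformly_convex X \<longleftrightarrow> (\<forall>\<epsilon>. 0 < \<epsilon> \<and> \<epsilon> < 2 \<longrightarrow> modulus_of_convexity X \<epsilon> > 0)"


section \<open>The spaces $C(K,X)$\<close>

text \<open>The compact space $K$ is a whole type \<open>'k\<close>; then \<open>'k \<Rightarrow>\<^sub>C 'x\<close> consists of all
  continuous functions from $K$ to $X$, and its norm is the supremum norm.\<close>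

definition fmult ::
  "('k::topological_space \<Rightarrow>\<^sub>C complex) \<Rightarrow> ('k \<Rightarrow>\<^sub>C 'x::complex_normed_vector) \<Rightarrow> ('k \<Rightarrow>\<^sub>C 'x)" where
  "fmult \<phi> f = Bcontfun (\<lambda>t. apply_bcontfun \<phi> t *\<^sub>C apply_bcontfun f t)"

lemma apply_fmult [simp]:
  "apply_bcontfun (fmult \<phi> f) t = apply_bcontfun \<phi> t *\<^sub>C apply_bcontfun f t"
proof -
  have "norm (apply_bcontfun \<phi> t *\<^sub>C apply_bcontfun f t) \<le> norm \<phi> * norm f" for t
    unfolding norm_scaleC by (intro mult_mono norm_bounded norm_ge_zero)
  moreover have "continuous_on UNIV (\<lambda>t. apply_bcontfun \<phi> t *\<^sub>C apply_bcontfun f t)"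
    by (intro continuous_intros continuous_on_apply_bcontfun)
  ultimately have "(\<lambda>t. apply_bcontfun \<phi> t *\<^sub>C apply_bcontfun f t) \<in> bcontfun"
    by (intro bcontfun_normI)
  then show ?thesis
    by (simp add: fmult_def Bcontfun_inverse)
qed

instantiation bcontfun :: (topological_space, complex_normed_vector) complex_normed_vector
begin

definition scaleC_bcontfun :: "complex \<Rightarrow> ('a \<Rightarrow>\<^sub>C 'b) \<Rightarrow> ('a \<Rightarrow>\<^sub>C 'b)" where
  "scaleC_bcontfun c f = fmult (const_bcontfun c) f"

lemma apply_scaleC_bcontfun:
  fixes f :: "'a \<Rightarrow>\<^sub>C 'b"
  shows "apply_bcontfun (c *\<^sub>C f) t = c *\<^sub>C apply_bcontfun f t"
  by (simp add: scaleC_bcontfun_def const_bcontfun.rep_eq)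

instance
proof
  fix c d :: complex and r :: real and f g :: "'a \<Rightarrow>\<^sub>C 'b"
  show "c *\<^sub>C (f + g) = c *\<^sub>C f + c *\<^sub>C g"
    by (rule bcontfun_eqI) (simp add: apply_scaleC_bcontfun scaleC_add_right)
  show "(c + d) *\<^sub>C f = c *\<^sub>C f + d *\<^sub>C f"
    by (rule bcontfun_eqI) (simp add: apply_scaleC_bcontfun scaleC_add_left)
  show *: "c *\<^sub>C d *\<^sub>C f = (c * d) *\<^sub>C f" for c d and f :: "'a \<Rightarrow>\<^sub>C 'b"
    by (rule bcontfun_eqI) (simp add: apply_scaleC_bcontfun scaleC_scaleC)
  show one: "complex_of_real r *\<^sub>C f = r *\<^sub>R f" for r and f :: "'a \<Rightarrow>\<^sub>C 'b"
    by (rule bcontfun_eqI) (simp add: apply_scaleC_bcontfun scaleC_of_real)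
  have le: "norm (c *\<^sub>C f) \<le> cmod c * norm f" for c and f :: "'a \<Rightarrow>\<^sub>C 'b"
    by (rule norm_bound) (simp add: apply_scaleC_bcontfun norm_scaleC mult_left_mono norm_bounded)
  show "norm (c *\<^sub>C f) = cmod c * norm f"
  proof (cases "c = 0")
    case True
    then show ?thesis using one[of 0 f] by simp
  next
    case False
    have "f = inverse c *\<^sub>C c *\<^sub>C f"
      using False one[of 1 f] by (simp add: *)
    then have "norm f \<le> cmod (inverse c) * norm (c *\<^sub>C f)"
      using le[of "inverse c" "c *\<^sub>C f"] by simp
    then have "cmod c * norm f \<le> norm (c *\<^sub>C f)"
      using False by (simp add: norm_inverse norm_divide field_simps)
    with le[of c f] show ?thesis by simp
  qed
qed

end

definition tensor ::
  "('k::topological_space \<Rightarrow>\<^sub>C complex) \<Rightarrow> 'x::complex_normed_vector \<Rightarrow> ('k \<Rightarrow>\<^sub>C 'x)" where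
  "tensor \<phi> x = fmult \<phi> (const_bcontfun x)"

text \<open>The set of elementary tensors, not its linear span.\<close>

definition tensors ::
  "('k::topological_space \<Rightarrow>\<^sub>C complex) set \<Rightarrow> ('k \<Rightarrow>\<^sub>C 'x::complex_normed_vector) set" where
  "tensors A = {tensor \<phi> x | \<phi> x. \<phi> \<in> A}"


section \<open>Uniform algebras and vector-valued function spaces\<close>

text \<open>For scalar-valued functions, \<open>fmult\<close> is the pointwise product.\<close>

definition uniform_algebra :: "('k::topological_space \<Rightarrow>\<^sub>C complex) set \<Rightarrow> bool" where
  "uniform_algebra A \<longleftrightarrow>
     closed A \<and> csubspace A \<and> (\<forall>\<phi>\<in>A. \<forall>\<psi>\<in>A. fmult \<phi> \<psi> \<in> A) \<and>
     (\<forall>c. const_bcontfun c \<in> A) \<and>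
     (\<forall>s t. s \<noteq> t \<longrightarrow> (\<exists>\<phi>\<in>A. apply_bcontfun \<phi> s \<noteq> apply_bcontfun \<phi> t))"

definition base_algebra ::
  "('k::topological_space \<Rightarrow>\<^sub>C 'x::complex_normed_vector) set \<Rightarrow> ('k \<Rightarrow>\<^sub>C complex) set" where
  "base_algebra F = {\<phi>. \<exists>f\<in>F. \<exists>l\<in>cdual. apply_bcontfun \<phi> = l \<circ> apply_bcontfun f}"

definition function_space_over_uniform_algebra ::
  "('k::topological_space \<Rightarrow>\<^sub>C 'x::complex_normed_vector) set \<Rightarrow> bool" where
  "function_space_over_uniform_algebra F \<longleftrightarrow>
     closed F \<and> csubspace F \<and> uniform_algebra (base_algebra F) \<and>
     (\<forall>\<phi>\<in>base_algebra F. \<forall>f\<in>F. fmult \<phi> f \<in> F)"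

definition is_boundary ::
  "('k::topological_space \<Rightarrow>\<^sub>C complex) set \<Rightarrow> 'k set \<Rightarrow> bool" where
  "is_boundary A S \<longleftrightarrow> (\<forall>\<phi>\<in>A. \<exists>t\<in>S. cmod (apply_bcontfun \<phi> t) = norm \<phi>)"

text \<open>The least element with respect to inclusion.\<close>

definition shilov_boundary :: "('k::topological_space \<Rightarrow>\<^sub>C complex) set \<Rightarrow> 'k set" where
  "shilov_boundary A = (LEAST S. closed S \<and> is_boundary A S)"


section \<open>Daugavet points and Delta-points\<close>

text \<open>Here \<open>Z\<close> is a closed subspace of the ambient type, viewed as a Banach space in its own
  right; since it is closed and convex, closed convex hulls of its subsets may be formed in
  the ambient space.\<close>

definition Delta_set :: "'a::real_normed_vector set \<Rightarrow> real \<Rightarrow> 'a \<Rightarrow> 'a set" where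
  "Delta_set Z \<epsilon> z = {y\<in>Z. norm y \<le> 1 \<and> norm (z - y) \<ge> 2 - \<epsilon>}"

definition Delta_point :: "'a::real_normed_vector set \<Rightarrow> 'a \<Rightarrow> bool" where
  "Delta_point Z z \<longleftrightarrow>
     z \<in> Z \<and> norm z = 1 \<and> (\<forall>\<epsilon>>0. z \<in> closure (convex hull (Delta_set Z \<epsilon> z)))"

definition Daugavet_point :: "'a::real_normed_vector set \<Rightarrow> 'a \<Rightarrow> bool" where
  "Daugavet_point Z z \<longleftrightarrow>
     z \<in> Z \<and> norm z = 1 \<and>
     (\<forall>\<epsilon>>0. {y\<in>Z. norm y \<le> 1} = closure (convex hull (Delta_set Z \<epsilon> z)))"

end

theory Submission
  imports Defs
begin

text \<open>By the Hahn-Banach theorem every element of the function space attains its norm on the Shilov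
  boundary \<open>\<Gamma>\<close>. If no limit point of \<open>\<Gamma>\<close> is a norm-attaining point of \<open>f\<close>, then the
  set \<open>D\<close> of norm-attaining points in \<open>\<Gamma>\<close> is finite and \<open>f\<close> stays away from norm one on
  \<open>\<Gamma> - D\<close>. Hence, by uniform convexity, every \<open>g\<close> almost at distance 2 from \<open>f\<close> is close to
  \<open>- f\<close> at some point of \<open>D\<close>, and the convex function \<open>g \<mapsto> \<Sum>t\<in>D. \<parallel>g t + f t\<parallel>\<close> separates \<open>f\<close> from all
  such \<open>g\<close>.

  Conversely, near a norm-attaining limit point of \<open>\<Gamma>\<close> there are arbitrarily many disjoint
  open sets \<open>V i\<close> meeting \<open>\<Gamma>\<close>, and functions \<open>\<phi> i\<close> in the base algebra that take the value 1 in
  \<open>V i\<close>, are small outside it and have almost \<open>\<bar>\<phi> i\<bar> + \<bar>1 - \<phi> i\<bar> \<le> 1\<close>. Then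
  \<open>(1 - \<phi> i) y - \<phi> i f\<close> is almost in the unit ball and almost at distance 2 from \<open>f\<close>, and the average
  of these functions is close to \<open>y\<close>.\<close>

section \<open>Norming functionals\<close>

definition sublinear :: "('a::real_vector \<Rightarrow> real) \<Rightarrow> bool" where
  "sublinear q \<longleftrightarrow> (\<forall>x y. q (x + y) \<le> q x + q y) \<and> (\<forall>c>0. \<forall>x. q (c *\<^sub>R x) \<le> c * q x)"

lemma sublinear_add: "sublinear q \<Longrightarrow> q (x + y) \<le> q x + q y"
  by (simp add: sublinear_def)

text \<open>The definition asks only for an inequality at positive factors, which is easier to
  verify for infima. Applying it to the inverse factor gives the reverse inequality.\<close>

lemma sublinear_scaleR:
  assumes "sublinear q" "c \<ge> 0"
  shows "q (c *\<^sub>R x) = c * q x"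
proof -
  have le: "q (d *\<^sub>R y) \<le> d * q y" if "d > 0" for d y
    using assms(1) that by (simp add: sublinear_def)
  have pos: "q (d *\<^sub>R y) = d * q y" if "d > 0" for d y
  proof -
    have "q y \<le> inverse d * q (d *\<^sub>R y)"
      using le[of "inverse d" "d *\<^sub>R y"] that by simp
    then have "d * q y \<le> q (d *\<^sub>R y)"
      using that by (simp add: field_simps)
    with le[OF that] show ?thesis by (simp add: antisym)
  qed
  show ?thesis
  proof (cases "c = 0")
    case True
    \<comment> \<open>Doubling the zero vector gives \<open>q 0 = 2 * q 0\<close>, hence
      \<open>q 0 = 0\<close>.\<close>
    then show ?thesis using pos[of 2 0] by simp
  next
    case False
    then show ?thesis using pos assms(2) by simp
  qed
qed

lemma sublinear_zero: "sublinear q \<Longrightarrow> q 0 = 0"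
  using sublinear_scaleR[of q 0 0] by simp

lemma sublinear_ge: "sublinear q \<Longrightarrow> - q (- x) \<le> q x"
  using sublinear_add[of q x "- x"] sublinear_zero[of q] by simp

lemma sublinear_norm: "sublinear (norm :: 'a::real_normed_vector \<Rightarrow> real)"
  by (simp add: sublinear_def norm_triangle_ineq)

text \<open>The largest sublinear functional below \<open>q\<close> whose value at \<open>- y\<close> is \<open>- q y\<close>: a minimal
  sublinear functional coincides with all its shifts, which forces it to be additive.\<close>

definition sublinear_shift :: "('a::real_vector \<Rightarrow> real) \<Rightarrow> 'a \<Rightarrow> 'a \<Rightarrow> real" where
  "sublinear_shift q y x = (INF t\<in>{0..}. q (x + t *\<^sub>R y) - t * q y)"

lemma sublinear_shift_le:
  assumes "sublinear q" "t \<ge> 0"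
  shows "sublinear_shift q y x \<le> q (x + t *\<^sub>R y) - t * q y"
  unfolding sublinear_shift_def
proof (rule cINF_lower)
  \<comment> \<open>The infimum is meaningful only for a set bounded below; subadditivity provides
    the bound \<open>- q (- x)\<close>, independent of t.\<close>
  show "bdd_below ((\<lambda>t. q (x + t *\<^sub>R y) - t * q y) ` {0..})"
  proof (rule bdd_belowI2)
    fix t :: real assume "t \<in> {0..}"
    then show "- q (- x) \<le> q (x + t *\<^sub>R y) - t * q y"
      using sublinear_add[OF assms(1), of "x + t *\<^sub>R y" "- x"] sublinear_scaleR[OF assms(1), of t y] by simp
  qed
qed (use assms in auto)

lemma sublinear_shift_ge:
  assumes "\<And>t. t \<ge> 0 \<Longrightarrow> z \<le> q (x + t *\<^sub>R y) - t * q y"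
  shows "z \<le> sublinear_shift q y x"
  unfolding sublinear_shift_def by (rule cINF_greatest) (use assms in auto)

lemma sublinear_shift:
  assumes q: "sublinear q"
  shows "sublinear (sublinear_shift q y)"
  unfolding sublinear_def
proof (intro conjI allI impI)
  fix u v
  \<comment> \<open>Shifts s for u and t for v combine to the shift s + t for u + v; afterwards the
    infima over t and s are taken one after the other.\<close>
  have *: "sublinear_shift q y (u + v) \<le> (q (u + s *\<^sub>R y) - s * q y) + (q (v + t *\<^sub>R y) - t * q y)"
    if "s \<ge> 0" "t \<ge> 0" for s t
    using sublinear_shift_le[OF q, of "s + t" y "u + v"] that
      sublinear_add[OF q, of "u + s *\<^sub>R y" "v + t *\<^sub>R y"]
    by (simp add: algebra_simps)
  have "sublinear_shift q y (u + v) - (q (u + s *\<^sub>R y) - s * q y) \<le> sublinear_shift q y v"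
    if "s \<ge> 0" for s
    by (rule sublinear_shift_ge) (use *[OF that] in \<open>simp add: algebra_simps\<close>)
  then have "sublinear_shift q y (u + v) - sublinear_shift q y v \<le> sublinear_shift q y u"
    by (intro sublinear_shift_ge) (simp add: algebra_simps)
  then show "sublinear_shift q y (u + v) \<le> sublinear_shift q y u + sublinear_shift q y v"
    by simp
next
  fix c :: real and x assume c: "c > 0"
  have "sublinear_shift q y (c *\<^sub>R x) / c \<le> sublinear_shift q y x"
  proof (rule sublinear_shift_ge)
    \<comment> \<open>Positive homogeneity comes from the substitution of c * t for t in the
      infimum.\<close>
    fix t :: real assume t: "t \<ge> 0"
    have "sublinear_shift q y (c *\<^sub>R x) \<le> q (c *\<^sub>R x + (c * t) *\<^sub>R y) - c * t * q y"
      using sublinear_shift_le[OF q, of "c * t"] c t by simp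
    also have "c *\<^sub>R x + (c * t) *\<^sub>R y = c *\<^sub>R (x + t *\<^sub>R y)"
      by (simp add: algebra_simps)
    finally show "sublinear_shift q y (c *\<^sub>R x) / c \<le> q (x + t *\<^sub>R y) - t * q y"
      using c sublinear_scaleR[OF q, of c "x + t *\<^sub>R y"] by (simp add: field_simps)
  qed
  then show "sublinear_shift q y (c *\<^sub>R x) \<le> c * sublinear_shift q y x"
    using c by (simp add: field_simps)
qed

lemma minimal_sublinear_linear:
  assumes q: "sublinear q" and min: "\<And>q'. sublinear q' \<Longrightarrow> q' \<le> q \<Longrightarrow> q' = q"
  shows "linear q"
proof -
  have shift: "sublinear_shift q y = q" for y
    by (rule min[OF sublinear_shift[OF q]], rule le_funI)
      (use sublinear_shift_le[OF q, of 0] in simp)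
  \<comment> \<open>The shift by t = 1 gives \<open>q x + q y <= q (x + y)\<close>, the converse of
    subadditivity.\<close>
  have add: "q (x + y) = q x + q y" for x y
    using sublinear_shift_le[OF q, of 1 y x] sublinear_add[OF q, of x y] by (simp add: shift)
  have minus: "q (- x) = - q x" for x
    using add[of x "- x"] sublinear_zero[OF q] by simp
  show ?thesis
  proof (rule linearI)
    show "q (c *\<^sub>R x) = c *\<^sub>R q x" for c x
    proof (cases "c \<ge> 0")
      case True
      then show ?thesis by (simp add: sublinear_scaleR[OF q])
    next
      case False
      then have "q ((- c) *\<^sub>R x) = - c * q x"
        by (intro sublinear_scaleR[OF q]) simp
      then show ?thesis by (simp add: minus)
    qed
  qed (rule add)
qed

text \<open>Subadditivity survives the infimum because the smaller of two members of a chain can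
  serve for both summands. The bound \<open>- p (- x)\<close> keeps every infimum finite.\<close>

lemma sublinear_INF_chain:
  assumes C: "C \<noteq> {}" "\<And>q. q \<in> C \<Longrightarrow> sublinear q \<and> q \<le> p"
    and chain: "\<And>q r. q \<in> C \<Longrightarrow> r \<in> C \<Longrightarrow> q \<le> r \<or> r \<le> q"
  shows "sublinear (\<lambda>x. INF q\<in>C. q x)" "\<And>q x. q \<in> C \<Longrightarrow> (INF q\<in>C. q x) \<le> q x"
proof -
  have bdd: "bdd_below ((\<lambda>q. q x) ` C)" for x
  proof (rule bdd_belowI2)
    fix q assume "q \<in> C"
    then show "- p (- x) \<le> q x"
      using C(2)[of q] sublinear_ge[of q x] le_funD[of q p "- x"] by fastforce
  qed
  show low: "(INF q\<in>C. q x) \<le> q x" if "q \<in> C" for q x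
    by (rule cINF_lower[OF bdd that])
  show "sublinear (\<lambda>x. INF q\<in>C. q x)"
    unfolding sublinear_def
  proof (intro conjI allI impI)
    fix x y
    have *: "(INF q\<in>C. q (x + y)) \<le> q x + r y" if qr: "q \<in> C" "r \<in> C" for q r
    proof -
      obtain s where s: "s \<in> C" "s \<le> q" "s \<le> r"
        using chain[OF qr] qr by blast
      have "(INF q\<in>C. q (x + y)) \<le> s (x + y)"
        by (rule low[OF s(1)])
      also have "\<dots> \<le> s x + s y"
        using C(2)[OF s(1)] sublinear_add by blast
      also have "\<dots> \<le> q x + r y"
        using s by (intro add_mono) (auto dest: le_funD)
      finally show ?thesis .
    qed
    have "(INF q\<in>C. q (x + y)) - q x \<le> (INF q\<in>C. q y)" if "q \<in> C" for q
      by (rule cINF_greatest[OF C(1)]) (use *[OF that] in \<open>simp add: algebra_simps\<close>)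
    then have "(INF q\<in>C. q (x + y)) - (INF q\<in>C. q y) \<le> (INF q\<in>C. q x)"
      by (intro cINF_greatest[OF C(1)]) (simp add: algebra_simps)
    then show "(INF q\<in>C. q (x + y)) \<le> (INF q\<in>C. q x) + (INF q\<in>C. q y)"
      by simp
  next
    fix c :: real and x assume c: "c > 0"
    have "(INF q\<in>C. q (c *\<^sub>R x)) / c \<le> (INF q\<in>C. q x)"
    proof (rule cINF_greatest[OF C(1)])
      fix q assume "q \<in> C"
      then show "(INF q\<in>C. q (c *\<^sub>R x)) / c \<le> q x"
        using low[of q "c *\<^sub>R x"] C(2)[of q] sublinear_scaleR[of q c x] c by (simp add: field_simps)
    qed
    then show "(INF q\<in>C. q (c *\<^sub>R x)) \<le> c * (INF q\<in>C. q x)"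
      using c by (simp add: field_simps)
  qed
qed

lemma linear_below_sublinear:
  assumes p: "sublinear p"
  shows "\<exists>f. linear f \<and> f \<le> p"
proof -
  define S where "S = {q. sublinear q \<and> q \<le> p}"
  \<comment> \<open>The order is reversed, so that the maximal element from Zorn's lemma is a
    minimal sublinear functional.\<close>
  let ?P = "\<lambda>q r :: 'a \<Rightarrow> real. r \<le> q"
  have "\<exists>m\<in>S. \<forall>q\<in>S. ?P m q \<longrightarrow> q = m"
  proof (rule predicate_Zorn)
    show "partial_order_on S (relation_of ?P S)"
      by (rule partial_order_on_relation_ofI) auto
  next
    fix C assume "C \<in> Chains (relation_of ?P S)"
    then have CS: "C \<subseteq> S" and chain: "\<And>q r. q \<in> C \<Longrightarrow> r \<in> C \<Longrightarrow> q \<le> r \<or> r \<le> q"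
      by (auto simp: Chains_def relation_of_def)
    show "\<exists>u\<in>S. \<forall>q\<in>C. ?P q u"
    proof (cases "C = {}")
      case True
      then show ?thesis using p by (auto simp: S_def)
    next
      case False
      have sub: "\<And>q. q \<in> C \<Longrightarrow> sublinear q \<and> q \<le> p"
        using CS by (auto simp: S_def)
      have inf: "sublinear (\<lambda>x. INF q\<in>C. q x)"
        by (rule sublinear_INF_chain(1)[OF False]) (use sub chain in blast)+
      have le: "(\<lambda>x. INF q\<in>C. q x) \<le> q" if "q \<in> C" for q
        by (rule le_funI, rule sublinear_INF_chain(2)[OF False _ _ that]) (use sub chain in blast)+
      moreover obtain q where "q \<in> C"
        using False by blast
      ultimately have "(\<lambda>x. INF q\<in>C. q x) \<le> p"
        using sub order_trans by blast
      with inf le show ?thesis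
        by (auto simp: S_def intro!: bexI[of _ "\<lambda>x. INF q\<in>C. q x"])
    qed
  qed
  then obtain m where m: "sublinear m" "m \<le> p" "\<And>q. sublinear q \<Longrightarrow> q \<le> p \<Longrightarrow> q \<le> m \<Longrightarrow> q = m"
    by (auto simp: S_def)
  have "linear m"
    by (rule minimal_sublinear_linear) (use m order_trans in blast)+
  with m(2) show ?thesis by blast
qed

section \<open>Hahn-Banach: functionals that attain the norm at a given point\<close>

lemma real_norming_functional:
  fixes x :: "'a::real_normed_vector"
  obtains f :: "'a \<Rightarrow> real" where "linear f" "\<And>y. f y \<le> norm y" "f x = norm x"
proof -
  \<comment> \<open>Shifting the norm along x replaces an extension from the line through x: a
    linear functional below the shift is at most \<open>- norm x\<close> at \<open>- x\<close>,
    hence at least \<open>norm x\<close> at x.\<close>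
  have norm: "sublinear_shift norm x y \<le> norm (y + t *\<^sub>R x) - t * norm x" if "t \<ge> 0" for t y
    using sublinear_shift_le[OF sublinear_norm that] .
  obtain f where f: "linear f" "f \<le> sublinear_shift norm x"
    using linear_below_sublinear[OF sublinear_shift[OF sublinear_norm]] by blast
  have le: "f y \<le> norm y" for y
    using le_funD[OF f(2), of y] norm[of 0 y] by simp
  moreover have "f (- x) \<le> - norm x"
    using le_funD[OF f(2), of "- x"] norm[of 1 "- x"] by simp
  ultimately show ?thesis
    using f(1) le[of x] linear_neg[OF f(1), of x] by (intro that[of f]) auto
qed

text \<open>The real functional f is the real part of a unique complex-linear l, and a rotation of
  the argument carries the bound on f over to the modulus of l.\<close>

lemma norming_functional:
  fixes x :: "'a::complex_normed_vector"
  obtains l where "l \<in> cdual" "\<And>y. cmod (l y) \<le> norm y" "cmod (l x) = norm x"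
proof -
  obtain f :: "'a \<Rightarrow> real" where f: "linear f" "\<And>y. f y \<le> norm y" "f x = norm x"
    using real_norming_functional[of x] by blast
  have i: "\<i> *\<^sub>C c *\<^sub>R y = c *\<^sub>R \<i> *\<^sub>C y" for c and y :: 'a
    by (simp add: scaleC_of_real[symmetric] scaleC_scaleC mult.commute)
  have ii: "\<i> *\<^sub>C \<i> *\<^sub>C y = - y" for y :: 'a
    using scaleC_of_real[of "- 1" y] by (simp add: scaleC_scaleC)
  define l where "l y = Complex (f y) (- f (\<i> *\<^sub>C y))" for y
  have add: "l (y + z) = l y + l z" for y z
    by (simp add: l_def scaleC_add_right linear_add[OF f(1)] complex_eq_iff)
  have real: "l (c *\<^sub>R y) = c *\<^sub>R l y" for c y
    by (simp add: l_def i linear_scale[OF f(1)] complex_eq_iff)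
  have imag: "l (\<i> *\<^sub>C y) = \<i> * l y" for y
    by (simp add: l_def ii linear_neg[OF f(1)] complex_eq_iff)
  have scale: "l (c *\<^sub>C y) = c * l y" for c y
  proof -
    have "c = complex_of_real (Re c) + complex_of_real (Im c) * \<i>"
      by (simp add: complex_eq_iff)
    then have "c *\<^sub>C y = (complex_of_real (Re c) + complex_of_real (Im c) * \<i>) *\<^sub>C y"
      by (rule arg_cong)
    also have "\<dots> = Re c *\<^sub>R y + Im c *\<^sub>R \<i> *\<^sub>C y"
      by (simp only: scaleC_add_left scaleC_scaleC[symmetric] scaleC_of_real)
    also have "l \<dots> = c * l y"
      by (simp add: add real imag complex_eq_iff)
    finally show ?thesis .
  qed
  have le: "cmod (l y) \<le> norm y" for y
  proof (cases "l y = 0")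
    case False
    \<comment> \<open>The unimodular factor c turns \<open>l y\<close> into a nonnegative real, so
      that its modulus becomes a value of f.\<close>
    define c where "c = cnj (l y) / cmod (l y)"
    have c: "cmod c = 1"
      using False by (simp add: c_def norm_divide)
    have "l (c *\<^sub>C y) = cmod (l y)"
      using False by (simp add: scale c_def complex_norm_square[symmetric] power2_eq_square mult.commute)
    then have "cmod (l y) = f (c *\<^sub>C y)"
      by (simp add: l_def complex_eq_iff)
    also have "\<dots> \<le> norm y"
      using f(2)[of "c *\<^sub>C y"] by (simp add: norm_scaleC c)
    finally show ?thesis .
  qed simp
  have "bounded_linear l"
    by (rule bounded_linear_intro[of _ 1]) (simp_all add: add real le)
  then have "l \<in> cdual"
    by (simp add: cdual_def scale)
  moreover have "cmod (l x) = norm x"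
    using le[of x] abs_Re_le_cmod[of "l x"] by (simp add: l_def f(3))
  ultimately show ?thesis
    using le that by blast
qed


section \<open>Spaces of continuous functions\<close>

lemma apply_bcontfun_sum:
  fixes f :: "'i \<Rightarrow> 'k::topological_space \<Rightarrow>\<^sub>C 'x::real_normed_vector"
  shows "apply_bcontfun (\<Sum>i\<in>I. f i) t = (\<Sum>i\<in>I. apply_bcontfun (f i) t)"
  by (induction I rule: infinite_finite_induct) simp_all

lemma bounded_linear_apply_bcontfun:
  "bounded_linear (\<lambda>f :: 'k::topological_space \<Rightarrow>\<^sub>C 'x::real_normed_vector. apply_bcontfun f t)"
  by (rule bounded_linear_intro[of _ 1]) (simp_all add: norm_bounded)

lemma apply_bcontfun_attains_norm:
  fixes f :: "'k::topological_space \<Rightarrow>\<^sub>C 'x::real_normed_vector"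
  assumes "compact (UNIV :: 'k set)"
  obtains t where "norm (apply_bcontfun f t) = norm f"
proof -
  have "continuous_on UNIV (\<lambda>t. norm (apply_bcontfun f t))"
    by (intro continuous_intros continuous_on_apply_bcontfun)
  then obtain t where "\<And>s. norm (apply_bcontfun f s) \<le> norm (apply_bcontfun f t)"
    using continuous_attains_sup[OF assms] by (metis UNIV_I UNIV_not_empty)
  then have "norm f \<le> norm (apply_bcontfun f t)"
    by (intro norm_bound)
  then show ?thesis
    using norm_bounded[of f t] by (intro that[of t]) simp
qed

lemma norm_le_on_compact:
  fixes f :: "'k::topological_space \<Rightarrow>\<^sub>C 'x::real_normed_vector"
  assumes "compact E" "0 < c" "\<And>t. t \<in> E \<Longrightarrow> norm (apply_bcontfun f t) < c"
  obtains m where "0 \<le> m" "m < c" "\<And>t. t \<in> E \<Longrightarrow> norm (apply_bcontfun f t) \<le> m"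
proof (cases "E = {}")
  case True
  then show ?thesis
    using assms(2) by (intro that[of 0]) simp_all
next
  case False
  have "continuous_on E (\<lambda>t. norm (apply_bcontfun f t))"
    by (intro continuous_on_norm continuous_on_apply_bcontfun)
  then obtain u where "u \<in> E" "\<forall>t\<in>E. norm (apply_bcontfun f t) \<le> norm (apply_bcontfun f u)"
    using continuous_attains_sup[OF assms(1) False] by blast
  then show ?thesis
    using assms(3) by (intro that[of "norm (apply_bcontfun f u)"]) simp_all
qed

lemma closed_norm_eq:
  fixes f :: "'k::topological_space \<Rightarrow>\<^sub>C 'x::real_normed_vector"
  shows "closed {t. norm (apply_bcontfun f t) = c}"
  by (intro closed_Collect_eq continuous_intros continuous_on_apply_bcontfun)

lemma csubspace_scaleR: "csubspace S \<Longrightarrow> x \<in> S \<Longrightarrow> c *\<^sub>R x \<in> S"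
  unfolding csubspace_def by (metis scaleC_of_real)

lemma csubspace_subspace: "csubspace S \<Longrightarrow> subspace S"
  by (simp add: subspace_def csubspace_scaleR) (simp add: csubspace_def)

section \<open>The Shilov boundary and peak functions\<close>

context
  fixes A :: "('k::t2_space \<Rightarrow>\<^sub>C complex) set"
  assumes uniform_algebra: "uniform_algebra A"
    and compact_UNIV: "compact (UNIV :: 'k set)"
begin

lemma closed_A: "closed A"
  and csubspace_A: "csubspace A"
  and mult_A: "\<phi> \<in> A \<Longrightarrow> \<psi> \<in> A \<Longrightarrow> fmult \<phi> \<psi> \<in> A"
  and const_A: "const_bcontfun c \<in> A"
  using uniform_algebra by (auto simp: uniform_algebra_def)

lemma subspace_A: "subspace A"
  by (rule csubspace_subspace[OF csubspace_A])

lemma scaleC_A: "\<phi> \<in> A \<Longrightarrow> c *\<^sub>C \<phi> \<in> A"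
  using csubspace_A by (simp add: csubspace_def)

lemma separates:
  assumes "s \<noteq> t"
  obtains \<phi> where "\<phi> \<in> A" "apply_bcontfun \<phi> s \<noteq> apply_bcontfun \<phi> t"
  using uniform_algebra assms that unfolding uniform_algebra_def by blast

section \<open>Powers, logarithms and peaking functions in a uniform algebra\<close>

lemma power_A:
  assumes "\<psi> \<in> A"
  obtains \<theta> where "\<theta> \<in> A" "\<And>t. apply_bcontfun \<theta> t = apply_bcontfun \<psi> t ^ n"
proof -
  have "\<exists>\<theta>\<in>A. \<forall>t. apply_bcontfun \<theta> t = apply_bcontfun \<psi> t ^ n"
  proof (induction n)
    case 0
    show ?case using const_A[of 1] by (intro bexI[of _ "const_bcontfun 1"]) simp_all
  next
    case (Suc n)
    then obtain \<theta> where "\<theta> \<in> A" "\<And>t. apply_bcontfun \<theta> t = apply_bcontfun \<psi> t ^ n"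
      by blast
    then show ?case
      using mult_A[OF assms] by (intro bexI[of _ "fmult \<psi> \<theta>"]) (simp_all add: scaleC_complex_def)
  qed
  then show ?thesis using that by blast
qed

text \<open>For r < 1 the logarithm series converges uniformly on the disc of radius r. Its partial
  sums are polynomials in \<psi>, and A is closed.\<close>

lemma Ln_A:
  assumes \<psi>: "\<psi> \<in> A" "norm \<psi> \<le> 1" and r: "0 \<le> r" "r < 1"
  obtains \<theta> where "\<theta> \<in> A" "\<And>t. apply_bcontfun \<theta> t = Ln (1 - of_real r * apply_bcontfun \<psi> t)"
proof -
  have "\<exists>p\<in>A. \<forall>t. apply_bcontfun p t = apply_bcontfun \<psi> t ^ n" for n
    using power_A[OF \<psi>(1), of n] by metis
  then obtain p where p: "\<And>n. p n \<in> A" "\<And>n t. apply_bcontfun (p n) t = apply_bcontfun \<psi> t ^ n"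
    by metis
  \<comment> \<open>At n = 0 the division by zero yields coefficient 0, in accordance with the
    missing constant term of the series.\<close>
  define q where "q n = (- of_real (r ^ n) / of_nat n :: complex) *\<^sub>C p n" for n
  have q: "apply_bcontfun (q n) t = - ((of_real r * apply_bcontfun \<psi> t) ^ n) / of_nat n" for n t
    by (simp add: q_def apply_scaleC_bcontfun scaleC_complex_def p power_mult_distrib)
  have \<psi>1: "cmod (apply_bcontfun \<psi> t) \<le> 1" for t
    using norm_bounded[of \<psi> t] \<psi>(2) by linarith
  have le: "cmod (of_real r * apply_bcontfun \<psi> t) \<le> r" for t
    using mult_left_mono[OF \<psi>1 r(1)] r by (simp add: norm_mult)
  have sums: "(\<lambda>n. apply_bcontfun (q n) t) sums Ln (1 - of_real r * apply_bcontfun \<psi> t)" for t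
    using Ln_series'[of "- (of_real r * apply_bcontfun \<psi> t)"] le[of t] r by (simp add: q)
  have "uniform_limit UNIV (\<lambda>n t. \<Sum>i<n. apply_bcontfun (q i) t)
      (\<lambda>t. \<Sum>i. apply_bcontfun (q i) t) sequentially"
  proof (rule Weierstrass_m_test)
    show "summable (\<lambda>n. r ^ n)"
      using r by (intro summable_geometric) simp
    fix n t
    have "cmod (apply_bcontfun (q n) t) = cmod (of_real r * apply_bcontfun \<psi> t) ^ n / real n"
      by (simp add: q norm_divide norm_power)
    also have "\<dots> \<le> r ^ n / 1"
    proof (cases "n = 0")
      case False
      then have "1 \<le> real n"
        by simp
      then show ?thesis
        using r(1) by (intro frac_le power_mono[OF le] norm_ge_zero zero_le_power) simp_all
    qed simp
    finally show "cmod (apply_bcontfun (q n) t) \<le> r ^ n" by simp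
  qed
  then have "uniform_limit UNIV (\<lambda>n. apply_bcontfun (\<Sum>i<n. q i))
      (\<lambda>t. Ln (1 - of_real r * apply_bcontfun \<psi> t)) sequentially"
    using sums by (simp add: apply_bcontfun_sum[abs_def] sums_iff)
  then obtain \<theta> where \<theta>: "(\<lambda>t. Ln (1 - of_real r * apply_bcontfun \<psi> t)) = apply_bcontfun \<theta>"
      "(\<lambda>n. \<Sum>i<n. q i) \<longlonglongrightarrow> \<theta>"
    by (rule uniform_limit_bcontfunE) simp
  have "(\<Sum>i<n. q i) \<in> A" for n
    by (intro subspace_sum[OF subspace_A]) (simp add: q_def scaleC_A p)
  then have "\<theta> \<in> A"
    using closed_sequentially[OF closed_A _ \<theta>(2)] by blast
  then show ?thesis
    using \<theta>(1) by (intro that[of \<theta>]) metis+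
qed

text \<open>A nonzero function attaining its norm nowhere on E has, once normalised, modulus at most
  some m < 1 on the compact set E. A high power is as small there as desired and keeps the value 1
  at s.\<close>

lemma not_boundary_peak:
  assumes E: "closed E" "\<not> is_boundary A E" and "\<delta> > 0"
  obtains \<psi> s where "\<psi> \<in> A" "norm \<psi> = 1" "apply_bcontfun \<psi> s = 1"
    "\<And>t. t \<in> E \<Longrightarrow> cmod (apply_bcontfun \<psi> t) < \<delta>"
proof -
  obtain \<phi> where \<phi>: "\<phi> \<in> A" "\<And>t. t \<in> E \<Longrightarrow> cmod (apply_bcontfun \<phi> t) \<noteq> norm \<phi>"
    using E(2) by (auto simp: is_boundary_def)
  show ?thesis
  proof (cases "norm \<phi> = 0")
    \<comment> \<open>The zero function attains its norm everywhere, so E is empty and the constant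
      1 serves.\<close>
    case True
    then have "E = {}"
      using \<phi>(2) by auto
    moreover have "norm (const_bcontfun 1 :: 'k \<Rightarrow>\<^sub>C complex) = 1"
      using norm_bounded[of "const_bcontfun 1 :: 'k \<Rightarrow>\<^sub>C complex" undefined]
      by (intro antisym norm_bound) simp_all
    ultimately show ?thesis
      using const_A[of 1] by (intro that[of "const_bcontfun 1" undefined]) simp_all
  next
    case False
    obtain s where s: "cmod (apply_bcontfun \<phi> s) = norm \<phi>"
      using apply_bcontfun_attains_norm[OF compact_UNIV] .
    define c where "c = 1 / apply_bcontfun \<phi> s"
    have s0: "apply_bcontfun \<phi> s \<noteq> 0"
      using s False by auto
    have c: "cmod c = 1 / norm \<phi>"
      by (simp add: c_def norm_divide s)
    define \<theta> where "\<theta> = c *\<^sub>C \<phi>"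
    have \<theta>: "\<theta> \<in> A" "norm \<theta> = 1" "apply_bcontfun \<theta> s = 1"
      using False s0 by (simp_all add: \<theta>_def scaleC_A \<phi> norm_scaleC c apply_scaleC_bcontfun scaleC_complex_def)
        (simp add: c_def)
    have lt: "cmod (apply_bcontfun \<theta> t) < 1" if "t \<in> E" for t
      using \<phi>(2)[OF that] norm_bounded[of \<phi> t] False
      by (simp add: \<theta>_def apply_scaleC_bcontfun norm_scaleC c field_simps)
    obtain m where m: "0 \<le> m" "m < 1" "\<And>t. t \<in> E \<Longrightarrow> cmod (apply_bcontfun \<theta> t) \<le> m"
      using norm_le_on_compact[OF compact_Int_closed[OF compact_UNIV E(1)], of 1 \<theta>] lt by auto
    obtain n where n: "m ^ n < \<delta>"
      using real_arch_pow_inv[OF \<open>\<delta> > 0\<close> m(2)] by blast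
    obtain \<psi> where \<psi>: "\<psi> \<in> A" "\<And>t. apply_bcontfun \<psi> t = apply_bcontfun \<theta> t ^ n"
      using power_A[OF \<theta>(1), of n] by blast
    show ?thesis
    proof (rule that[of \<psi> s])
      have "norm \<psi> \<le> 1"
      proof (rule norm_bound)
        show "cmod (apply_bcontfun \<psi> t) \<le> 1" for t
          using norm_bounded[of \<theta> t] \<theta>(2) by (simp add: \<psi> norm_power power_le_one)
      qed
      moreover have "1 \<le> norm \<psi>"
        using norm_bounded[of \<psi> s] by (simp add: \<psi> \<theta>)
      ultimately show "norm \<psi> = 1" by simp
      fix t assume "t \<in> E"
      then have "cmod (apply_bcontfun \<psi> t) \<le> m ^ n"
        using m by (simp add: \<psi> norm_power power_mono)
      with n show "cmod (apply_bcontfun \<psi> t) < \<delta>" by simp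
    qed (simp_all add: \<psi> \<theta>)
  qed
qed

section \<open>Existence of a least closed boundary\<close>

text \<open>If \<open>V\<close>, cut out by \<open>\<Phi>\<close>, misses some boundary \<open>S\<close>, then a function \<open>\<psi>\<close> that is small on
  \<open>E - V\<close> makes all products \<open>\<psi> \<phi>\<close> with \<open>\<phi> \<in> \<Phi>\<close> of norm less than one, so that \<open>\<psi>\<close> can attain
  its norm only inside \<open>V\<close>, hence not on \<open>S\<close>.\<close>

lemma is_boundary_diff:
  assumes \<Phi>: "finite \<Phi>" "\<Phi> \<subseteq> A" and V: "V = {t. \<forall>\<phi>\<in>\<Phi>. cmod (apply_bcontfun \<phi> t) < 1}" "open V"
    and S: "is_boundary A S" "S \<inter> V = {}" and E: "closed E" "is_boundary A E"
  shows "is_boundary A (E - V)"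
proof (rule ccontr)
  assume nb: "\<not> is_boundary A (E - V)"
  \<comment> \<open>The threshold \<open>1 / (1 + M)\<close> outweighs every \<phi> in \<Phi>: at
    points of E outside V the product is at most \<open>M / (1 + M) < 1\<close>.\<close>
  define M where "M = (\<Sum>\<phi>\<in>\<Phi>. norm \<phi>)"
  have M: "norm \<phi> \<le> M" if "\<phi> \<in> \<Phi>" for \<phi>
    unfolding M_def using that \<Phi>(1) by (intro member_le_sum) auto
  have M0: "0 \<le> M"
    by (simp add: M_def sum_nonneg)
  then have pos: "0 < 1 / (1 + M)"
    by simp
  obtain \<psi> where \<psi>: "\<psi> \<in> A" "norm \<psi> = 1"
      "\<And>t. t \<in> E - V \<Longrightarrow> cmod (apply_bcontfun \<psi> t) < 1 / (1 + M)"
    by (rule not_boundary_peak[OF closed_Diff[OF E(1) V(2)] nb pos], rule that) simp_all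
  have less: "norm (fmult \<psi> \<phi>) < 1" if \<phi>: "\<phi> \<in> \<Phi>" for \<phi>
  proof -
    have "fmult \<psi> \<phi> \<in> A"
      using mult_A \<psi>(1) \<Phi>(2) \<phi> by blast
    then obtain t where t: "t \<in> E" "cmod (apply_bcontfun (fmult \<psi> \<phi>) t) = norm (fmult \<psi> \<phi>)"
      using E(2) unfolding is_boundary_def by blast
    have "cmod (apply_bcontfun \<psi> t) * cmod (apply_bcontfun \<phi> t) < 1"
    proof (cases "t \<in> V")
      case True
      have "cmod (apply_bcontfun \<psi> t) * cmod (apply_bcontfun \<phi> t) \<le> 1 * cmod (apply_bcontfun \<phi> t)"
        using norm_bounded[of \<psi> t] \<psi>(2) by (intro mult_right_mono) auto
      then show ?thesis
        using True \<phi> V(1) by fastforce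
    next
      case False
      have "cmod (apply_bcontfun \<psi> t) * cmod (apply_bcontfun \<phi> t) \<le> 1 / (1 + M) * M"
        using \<psi>(3)[of t] t(1) False norm_bounded[of \<phi> t] M[OF \<phi>] M0 by (intro mult_mono) auto
      also have "\<dots> < 1"
        using M0 by simp
      finally show ?thesis .
    qed
    then show ?thesis
      using t(2) by (simp add: scaleC_complex_def norm_mult)
  qed
  \<comment> \<open>Where \<psi> has modulus 1, the bound on \<open>fmult \<psi> \<phi>\<close> is a
    bound on \<phi> itself, which puts this point of S into V.\<close>
  obtain t where t: "t \<in> S" "cmod (apply_bcontfun \<psi> t) = 1"
    using S(1) \<psi>(1,2) unfolding is_boundary_def by fastforce
  have "cmod (apply_bcontfun \<phi> t) < 1" if "\<phi> \<in> \<Phi>" for \<phi>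
    using less[OF that] norm_bounded[of "fmult \<psi> \<phi>" t] t(2) by (simp add: scaleC_complex_def norm_mult)
  then show False
    using t(1) S(2) V(1) by blast
qed

text \<open>Functions of A generate the topology of K: those separating t from the points outside U
  are normalised, and compactness of \<open>- U\<close> leaves finitely many.\<close>

lemma basic_neighbourhood:
  assumes "open U" "t \<in> U"
  obtains \<Phi> where "finite \<Phi>" "\<Phi> \<subseteq> A" "\<And>\<phi>. \<phi> \<in> \<Phi> \<Longrightarrow> apply_bcontfun \<phi> t = 0"
    "{s. \<forall>\<phi>\<in>\<Phi>. cmod (apply_bcontfun \<phi> s) < 1} \<subseteq> U"
proof -
  have "\<exists>\<phi>\<in>A. apply_bcontfun \<phi> t = 0 \<and> cmod (apply_bcontfun \<phi> s) > 1" if "s \<in> - U" for s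
  proof -
    have "s \<noteq> t"
      using that assms(2) by blast
    then obtain \<phi> where \<phi>: "\<phi> \<in> A" "apply_bcontfun \<phi> s \<noteq> apply_bcontfun \<phi> t"
      using separates by blast
    \<comment> \<open>Affine normalisation to 0 at t and 2 at s. Modulus above 1 is then an open
      condition around s, as the covering argument requires.\<close>
    define \<theta> where "\<theta> = (2 / (apply_bcontfun \<phi> s - apply_bcontfun \<phi> t)) *\<^sub>C
      (\<phi> - const_bcontfun (apply_bcontfun \<phi> t))"
    have "\<theta> \<in> A"
      unfolding \<theta>_def by (intro scaleC_A subspace_diff[OF subspace_A] \<phi> const_A)
    moreover have "apply_bcontfun \<theta> t = 0" "apply_bcontfun \<theta> s = 2"
      using \<phi>(2) by (simp_all add: \<theta>_def apply_scaleC_bcontfun scaleC_complex_def field_simps)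
    ultimately show ?thesis
      by (intro bexI[of _ \<theta>]) simp_all
  qed
  then obtain h where h: "\<And>s. s \<in> - U \<Longrightarrow> h s \<in> A \<and> apply_bcontfun (h s) t = 0 \<and> cmod (apply_bcontfun (h s) s) > 1"
    by metis
  have "compact (- U)"
    using compact_Int_closed[OF compact_UNIV, of "- U"] assms(1) by (simp add: closed_Compl)
  moreover have "open {u. cmod (apply_bcontfun (h s) u) > 1}" for s
    by (intro open_Collect_less continuous_intros continuous_on_apply_bcontfun)
  moreover have "- U \<subseteq> (\<Union>s\<in>- U. {u. cmod (apply_bcontfun (h s) u) > 1})"
    using h by blast
  ultimately obtain D where D: "D \<subseteq> - U" "finite D" "- U \<subseteq> (\<Union>s\<in>D. {u. cmod (apply_bcontfun (h s) u) > 1})"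
    by (rule compactE_image)
  show ?thesis
  proof (rule that[of "h ` D"])
    show "{s. \<forall>\<phi>\<in>h ` D. cmod (apply_bcontfun \<phi> s) < 1} \<subseteq> U"
      using D(3) by fastforce
  qed (use D h in auto)
qed

text \<open>This also makes the \<open>LEAST\<close> in the definition meaningful. The candidate is
  the intersection of all closed boundaries; the point is that it is itself a boundary.\<close>

lemma shilov_boundary_least:
  shows "closed (shilov_boundary A)" "is_boundary A (shilov_boundary A)"
    "\<And>S. closed S \<Longrightarrow> is_boundary A S \<Longrightarrow> shilov_boundary A \<subseteq> S"
proof -
  define G where "G = \<Inter>{S. closed S \<and> is_boundary A S}"
  have closed: "closed G"
    unfolding G_def by (intro closed_Inter) auto
  have "is_boundary A G"
    unfolding is_boundary_def
  proof (rule ballI, rule ccontr)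
    fix \<phi> assume \<phi>: "\<phi> \<in> A" and none: "\<not> (\<exists>t\<in>G. cmod (apply_bcontfun \<phi> t) = norm \<phi>)"
    define C where "C = {t. cmod (apply_bcontfun \<phi> t) = norm \<phi>}"
    have "compact C"
      using compact_Int_closed[OF compact_UNIV closed_norm_eq[of \<phi> "norm \<phi>"]] by (simp add: C_def)
    \<comment> \<open>Open sets whose removal turns closed boundaries into boundaries. Each point of
      C lies outside some closed boundary, so such sets cover C.\<close>
    define \<V> where "\<V> = {V. open V \<and> (\<forall>E. closed E \<and> is_boundary A E \<longrightarrow> is_boundary A (E - V))}"
    have "C \<subseteq> \<Union>\<V>"
    proof
      fix t assume "t \<in> C"
      then have "t \<notin> G"
        using none by (auto simp: C_def)
      then obtain S where S: "closed S" "is_boundary A S" "t \<in> - S"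
        by (auto simp: G_def)
      obtain \<Phi> where \<Phi>: "finite \<Phi>" "\<Phi> \<subseteq> A" "\<And>\<phi>. \<phi> \<in> \<Phi> \<Longrightarrow> apply_bcontfun \<phi> t = 0"
          "{s. \<forall>\<phi>\<in>\<Phi>. cmod (apply_bcontfun \<phi> s) < 1} \<subseteq> - S"
        by (rule basic_neighbourhood[OF open_Compl[OF S(1)] S(3)], rule that) simp_all
      define V where "V = {s. \<forall>\<phi>\<in>\<Phi>. cmod (apply_bcontfun \<phi> s) < 1}"
      have "V = (\<Inter>\<phi>\<in>\<Phi>. {s. cmod (apply_bcontfun \<phi> s) < 1})"
        by (auto simp: V_def)
      then have "open V"
        using \<Phi>(1) by (auto intro!: open_INT open_Collect_less continuous_intros)
      moreover have "is_boundary A (E - V)" if "closed E" "is_boundary A E" for E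
        by (rule is_boundary_diff[OF \<Phi>(1,2) V_def \<open>open V\<close> S(2) _ that]) (use \<Phi>(4) V_def in blast)
      ultimately have "V \<in> \<V>"
        by (simp add: \<V>_def)
      moreover have "t \<in> V"
        by (simp add: V_def \<Phi>)
      ultimately show "t \<in> \<Union>\<V>"
        by blast
    qed
    then obtain D where D: "D \<subseteq> \<V>" "finite D" "C \<subseteq> \<Union>D"
      by (rule compactE[OF \<open>compact C\<close>]) (simp add: \<V>_def)
    \<comment> \<open>The whole space is a boundary by compactness, and the members of D are removed
      one at a time. What remains is a boundary missing every point where \<phi> attains its
      norm.\<close>
    have "closed (UNIV - \<Union>D) \<and> is_boundary A (UNIV - \<Union>D)"
      using D(2,1)
    proof (induction D)
      case empty
      show ?case
      proof -
        have "\<exists>t. cmod (apply_bcontfun \<psi> t) = norm \<psi>" for \<psi> :: "'k \<Rightarrow>\<^sub>C complex"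
        proof -
          obtain t where "cmod (apply_bcontfun \<psi> t) = norm \<psi>"
            using apply_bcontfun_attains_norm[OF compact_UNIV, of \<psi>] by blast
          then show ?thesis ..
        qed
        then show ?thesis
          unfolding is_boundary_def by auto
      qed
    next
      case (insert V D)
      have "UNIV - \<Union>(insert V D) = (UNIV - \<Union>D) - V"
        by blast
      with insert show ?case
        by (auto simp: \<V>_def intro: closed_Diff)
    qed
    then obtain t where "t \<notin> \<Union>D" "t \<in> C"
      using \<phi> unfolding is_boundary_def C_def by blast
    then show False
      using D(3) by blast
  qed
  with closed have "shilov_boundary A = G"
    unfolding shilov_boundary_def by (intro Least_equality) (auto simp: G_def)
  then show "closed (shilov_boundary A)" "is_boundary A (shilov_boundary A)"
    "\<And>S. closed S \<Longrightarrow> is_boundary A S \<Longrightarrow> shilov_boundary A \<subseteq> S"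
    using closed \<open>is_boundary A G\<close> by (auto simp: G_def)
qed

section \<open>Peak functions with range close to the unit interval\<close>

text \<open>On the unit disc \<open>- Ln (1 - r z)\<close> has bounded imaginary part, while its value at \<open>z = 1\<close>
  tends to infinity as \<open>r \<rightarrow> 1\<close>. After division by that value its range is therefore close
  to the interval \<open>[0, 1]\<close>, where \<open>\<bar>w\<bar> + \<bar>1 - w\<bar> = 1\<close>.\<close>

lemma shilov_peak:
  assumes U: "open U" "t0 \<in> U" "t0 \<in> shilov_boundary A" and "\<eta> > 0"
  obtains \<phi> s where "\<phi> \<in> A" "s \<in> U" "apply_bcontfun \<phi> s = 1"
    "\<And>t. cmod (apply_bcontfun \<phi> t) + cmod (1 - apply_bcontfun \<phi> t) \<le> 1 + \<eta>"
    "\<And>t. t \<notin> U \<Longrightarrow> cmod (apply_bcontfun \<phi> t) \<le> \<eta>"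
proof -
  \<comment> \<open>A closed boundary contains the Shilov boundary, but \<open>- U\<close> misses
    t0.\<close>
  have "\<not> is_boundary A (- U)"
    using shilov_boundary_least(3)[of "- U"] U by auto
  then obtain \<psi> s where \<psi>: "\<psi> \<in> A" "norm \<psi> = 1" "apply_bcontfun \<psi> s = 1"
      "\<And>t. t \<in> - U \<Longrightarrow> cmod (apply_bcontfun \<psi> t) < 1/2"
    using not_boundary_peak[of "- U" "1/2"] U(1) by (metis closed_Compl half_gt_zero zero_less_one)
  \<comment> \<open>The errors below add up to 6 / L for the sum of moduli and 3 / L off U, so L = 8
    / \<eta> suffices.\<close>
  define L where "L = 8 / \<eta>"
  have L: "L > 0" "8 / L = \<eta>"
    using \<open>\<eta> > 0\<close> by (simp_all add: L_def)
  \<comment> \<open>This r makes \<open>w s = exp (- L)\<close>, hence \<open>Ln (w s) = - L\<close>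
    and \<phi> takes the value 1 at s.\<close>
  define r where "r = 1 - exp (- L)"
  have r: "0 \<le> r" "r < 1" "1 - r = exp (- L)"
    using L by (simp_all add: r_def)
  obtain \<theta> where \<theta>: "\<theta> \<in> A" "\<And>t. apply_bcontfun \<theta> t = Ln (1 - of_real r * apply_bcontfun \<psi> t)"
    using Ln_A[OF \<psi>(1) _ r(1,2)] \<psi>(2) by auto
  define \<phi> where "\<phi> = of_real (- 1 / L) *\<^sub>C \<theta>"
  define w where "w t = 1 - of_real r * apply_bcontfun \<psi> t" for t
  have \<phi>: "apply_bcontfun \<phi> t = of_real (- 1 / L) * Ln (w t)" for t
    by (simp add: \<phi>_def apply_scaleC_bcontfun scaleC_complex_def \<theta> w_def)
  \<comment> \<open>The values of w lie in the right half-plane, so the imaginary part of the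
    logarithm is below pi / 2. Off U, \<psi> has modulus below 1/2, hence w has modulus at least 1/2
    and the real part is at least - ln 2.\<close>
  have bounds: "- L \<le> Re (Ln (w t))" "Re (Ln (w t)) \<le> 1" "\<bar>Im (Ln (w t))\<bar> \<le> 2"
      "t \<notin> U \<Longrightarrow> - 1 \<le> Re (Ln (w t))" for t
  proof -
    have \<psi>1: "cmod (apply_bcontfun \<psi> t) \<le> 1"
      using norm_bounded[of \<psi> t] \<psi>(2) by simp
    then have rp: "cmod (of_real r * apply_bcontfun \<psi> t) \<le> r"
      using mult_left_mono[OF \<psi>1 r(1)] r by (simp add: norm_mult)
    have Re: "1 - r \<le> Re (w t)"
      using complex_Re_le_cmod[of "of_real r * apply_bcontfun \<psi> t"] rp by (simp add: w_def)
    then have pos: "Re (w t) > 0" "w t \<noteq> 0"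
      using r by auto
    have low: "exp (- L) \<le> cmod (w t)"
      using Re complex_Re_le_cmod[of "w t"] r(3) by linarith
    have up: "cmod (w t) \<le> 2"
      using norm_triangle_ineq4[of 1 "of_real r * apply_bcontfun \<psi> t"] rp r by (simp add: w_def)
    have ReLn: "Re (Ln (w t)) = ln (cmod (w t))"
      using pos by simp
    show "- L \<le> Re (Ln (w t))"
      using low pos unfolding ReLn by (subst ln_ge_iff) auto
    have "ln (cmod (w t)) \<le> cmod (w t) - 1"
      using pos by (intro ln_le_minus_one) simp
    with up show "Re (Ln (w t)) \<le> 1"
      unfolding ReLn by linarith
    have "\<bar>Im (Ln (w t))\<bar> < pi / 2"
      using Re_Ln_pos_lt[OF pos(2)] pos(1) by simp
    then show "\<bar>Im (Ln (w t))\<bar> \<le> 2"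
      using pi_less_4 by linarith
    assume "t \<notin> U"
    then have "cmod (of_real r * apply_bcontfun \<psi> t) \<le> 1 * (1/2)"
      unfolding norm_mult using \<psi>(4)[of t] r by (intro mult_mono) auto
    then have "1/2 \<le> cmod (w t)"
      using norm_triangle_ineq2[of 1 "of_real r * apply_bcontfun \<psi> t"] by (simp add: w_def)
    then have "ln (1/2) \<le> ln (cmod (w t))"
      by (subst ln_le_cancel_iff) (use pos in auto)
    moreover have "ln (1/2) \<ge> - (1::real)"
      using ln_le_minus_one[of "2::real"] by (simp add: ln_div)
    ultimately show "- 1 \<le> Re (Ln (w t))"
      unfolding ReLn by linarith
  qed
  have Re: "Re (apply_bcontfun \<phi> t) = - Re (Ln (w t)) / L"
    and Im: "\<bar>Im (apply_bcontfun \<phi> t)\<bar> \<le> 2 / L" for t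
    using bounds(3)[of t] L by (simp_all add: \<phi> divide_right_mono abs_mult)
  have w_s: "w s = of_real (exp (- L))"
    by (simp add: w_def \<psi> r(3)[symmetric])
  show ?thesis
  proof (rule that[of \<phi> s])
    show "\<phi> \<in> A"
      by (simp add: \<phi>_def \<theta> scaleC_A)
    show "s \<in> U"
      using \<psi>(3) \<psi>(4)[of s] by force
    show "apply_bcontfun \<phi> s = 1"
      unfolding \<phi> w_s using L(1) by (subst Ln_of_real) (simp_all del: of_real_exp)
  next
    fix t
    have "- (1 / L) \<le> Re (apply_bcontfun \<phi> t)" "Re (apply_bcontfun \<phi> t) \<le> 1"
      using bounds(1,2)[of t] L unfolding Re by (simp_all add: field_simps)
    moreover have "cmod (apply_bcontfun \<phi> t) \<le> \<bar>Re (apply_bcontfun \<phi> t)\<bar> + \<bar>Im (apply_bcontfun \<phi> t)\<bar>"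
      by (rule cmod_le)
    moreover have "cmod (1 - apply_bcontfun \<phi> t) \<le> \<bar>1 - Re (apply_bcontfun \<phi> t)\<bar> + \<bar>Im (apply_bcontfun \<phi> t)\<bar>"
      using cmod_le[of "1 - apply_bcontfun \<phi> t"] by simp
    ultimately have "cmod (apply_bcontfun \<phi> t) + cmod (1 - apply_bcontfun \<phi> t) \<le> 1 + 2 * (1 / L) + 2 * (2 / L)"
      using Im[of t] L(1) by linarith
    also have "\<dots> \<le> 1 + \<eta>"
      using L(1) by (simp add: L(2)[symmetric] field_simps)
    finally show "cmod (apply_bcontfun \<phi> t) + cmod (1 - apply_bcontfun \<phi> t) \<le> 1 + \<eta>" .
  next
    fix t assume "t \<notin> U"
    then have "\<bar>Re (Ln (w t))\<bar> \<le> 1"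
      using bounds(2,4)[of t] by linarith
    then have "\<bar>Re (apply_bcontfun \<phi> t)\<bar> \<le> 1 / L"
      unfolding Re using L(1) by (simp add: divide_right_mono abs_divide)
    then have "cmod (apply_bcontfun \<phi> t) \<le> 1 / L + 2 / L"
      using cmod_le[of "apply_bcontfun \<phi> t"] Im[of t] by linarith
    also have "\<dots> \<le> \<eta>"
      using L(1) by (simp add: L(2)[symmetric] field_simps)
    finally show "cmod (apply_bcontfun \<phi> t) \<le> \<eta>" .
  qed
qed

end

text \<open>Composing h with a functional norming its value at a maximum point gives a scalar
  function in the base algebra with the same norm; a point of the Shilov boundary where that
  function peaks also works for h.\<close>

lemma attains_norm_on_shilov_boundary:
  fixes F :: "('k::t2_space \<Rightarrow>\<^sub>C 'x::complex_normed_vector) set"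
  assumes "compact (UNIV :: 'k set)" "uniform_algebra (base_algebra F)" "h \<in> F"
  obtains t where "t \<in> shilov_boundary (base_algebra F)" "norm (apply_bcontfun h t) = norm h"
proof -
  obtain s where s: "norm (apply_bcontfun h s) = norm h"
    using apply_bcontfun_attains_norm[OF assms(1)] .
  obtain l where l: "l \<in> cdual" "\<And>x. cmod (l x) \<le> norm x" "cmod (l (apply_bcontfun h s)) = norm (apply_bcontfun h s)"
    using norming_functional[of "apply_bcontfun h s"] by blast
  have le: "cmod (l (apply_bcontfun h t)) \<le> norm h" for t
    using l(2) norm_bounded[of h t] order_trans by blast
  have "continuous_on UNIV (\<lambda>t. l (apply_bcontfun h t))"
    by (rule bounded_linear.continuous_on[OF _ continuous_on_apply_bcontfun])
      (use l(1) in \<open>simp add: cdual_def\<close>)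
  then have "(\<lambda>t. l (apply_bcontfun h t)) \<in> bcontfun"
    using le by (rule bcontfun_normI)
  then obtain \<phi> where \<phi>: "(\<lambda>t. l (apply_bcontfun h t)) = apply_bcontfun \<phi>"
    by (rule bcontfunE)
  then have "\<phi> \<in> base_algebra F"
    unfolding base_algebra_def using assms(3) l(1) by (auto simp: o_def intro!: bexI)
  then obtain t where t: "t \<in> shilov_boundary (base_algebra F)" "cmod (apply_bcontfun \<phi> t) = norm \<phi>"
    using shilov_boundary_least(2)[OF assms(2,1)] unfolding is_boundary_def by blast
  have "norm h = cmod (apply_bcontfun \<phi> s)"
    using l(3) s by (simp add: \<phi>[symmetric])
  also have "\<dots> \<le> cmod (apply_bcontfun \<phi> t)"
    using norm_bounded[of \<phi> s] t(2) by simp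
  also have "\<dots> \<le> norm (apply_bcontfun h t)"
    using l(2) by (simp add: \<phi>[symmetric])
  finally show ?thesis
    using norm_bounded[of h t] t(1) by (intro that[of t]) simp_all
qed

section \<open>Delta-points and Daugavet points\<close>

lemma disjoint_open_neighbourhoods:
  fixes P :: "'a::t2_space set"
  assumes "finite P"
  obtains U where "\<And>p. p \<in> P \<Longrightarrow> open (U p)" "\<And>p. p \<in> P \<Longrightarrow> p \<in> U p"
    "\<And>p q. p \<in> P \<Longrightarrow> q \<in> P \<Longrightarrow> p \<noteq> q \<Longrightarrow> U p \<inter> U q = {}"
proof -
  have "\<exists>S T. p \<noteq> q \<longrightarrow> open S \<and> open T \<and> p \<in> S \<and> q \<in> T \<and> S \<inter> T = {}" for p q :: 'a
    using hausdorff[of p q] by (cases "p = q") simp_all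
  then obtain S T where ST: "\<And>p q :: 'a. p \<noteq> q \<Longrightarrow>
      open (S p q) \<and> open (T p q) \<and> p \<in> S p q \<and> q \<in> T p q \<and> S p q \<inter> T p q = {}"
    by metis
  \<comment> \<open>Both S p q and T q p are intersected, since the separation chosen for (p, q)
    need not be the swap of the one for (q, p).\<close>
  define U where "U p = (\<Inter>q\<in>P - {p}. S p q \<inter> T q p)" for p
  show ?thesis
  proof (rule that[of U])
    show "open (U p)" if "p \<in> P" for p
      unfolding U_def using assms ST by (intro open_INT ballI open_Int) auto
    show "p \<in> U p" if "p \<in> P" for p
      unfolding U_def
    proof (rule INT_I)
      fix q assume "q \<in> P - {p}"
      then have "p \<noteq> q" "q \<noteq> p"
        by auto
      then show "p \<in> S p q \<inter> T q p"
        using ST[of p q] ST[of q p] by simp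
    qed
    show "U p \<inter> U q = {}" if "p \<in> P" "q \<in> P" "p \<noteq> q" for p q
    proof -
      have "U p \<subseteq> S p q" "U q \<subseteq> T p q"
        using that unfolding U_def by blast+
      then show ?thesis
        using ST[OF that(3)] by blast
    qed
  qed
qed

lemma islimpt_infinite_Int_open:
  fixes t :: "'a::t1_space"
  assumes "t islimpt S" "open W" "t \<in> W"
  shows "infinite (S \<inter> W)"
proof
  assume "finite (S \<inter> W)"
  then have "open (W - (S \<inter> W - {t}))"
    by (intro open_Diff assms(2) finite_imp_closed) auto
  moreover have "t \<in> W - (S \<inter> W - {t})"
    using assms(3) by simp
  ultimately obtain s where "s \<in> S" "s \<in> W - (S \<inter> W - {t})" "s \<noteq> t"
    using assms(1) unfolding islimpt_def by metis
  then show False by blast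
qed

text \<open>Unpacks the infimum: \<delta> is the modulus of convexity itself, and the factor 2 comes
  from replacing the midpoint by the sum.\<close>

lemma uniformly_convex_midpoint:
  assumes "uniformly_convex TYPE('x::real_normed_vector)" "0 < \<epsilon>" "\<epsilon> < 2"
  obtains \<delta> where "\<delta> > 0" "\<And>x y :: 'x. norm x \<le> 1 \<Longrightarrow> norm y \<le> 1 \<Longrightarrow> norm (x - y) \<ge> \<epsilon> \<Longrightarrow>
    norm (x + y) \<le> 2 - 2 * \<delta>"
proof -
  let ?S = "{1 - norm ((1/2) *\<^sub>R (x + y)) | x y :: 'x. norm x \<le> 1 \<and> norm y \<le> 1 \<and> norm (x - y) \<ge> \<epsilon>}"
  have bdd: "bdd_below ?S"
  proof (rule bdd_belowI[of _ 0])
    fix z assume "z \<in> ?S"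
    then obtain x y :: 'x where "z = 1 - norm ((1/2) *\<^sub>R (x + y))" "norm x \<le> 1" "norm y \<le> 1"
      by blast
    then show "0 \<le> z"
      using norm_triangle_ineq[of x y] by simp
  qed
  have pos: "Inf ?S > 0"
    using assms unfolding uniformly_convex_def modulus_of_convexity_def by blast
  show ?thesis
  proof (rule that[OF pos])
    fix x y :: 'x assume "norm x \<le> 1" "norm y \<le> 1" "norm (x - y) \<ge> \<epsilon>"
    then have "Inf ?S \<le> 1 - norm ((1/2) *\<^sub>R (x + y))"
      by (intro cInf_lower bdd) blast
    then show "norm (x + y) \<le> 2 - 2 * Inf ?S"
      by simp
  qed
qed

lemma Daugavet_point_imp_Delta_point: "Daugavet_point Z z \<Longrightarrow> Delta_point Z z"
  unfolding Daugavet_point_def Delta_point_def by force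

section \<open>From Delta-points to norm-attaining limit points\<close>

lemma Delta_point_imp_limit_point:
  fixes F :: "('k::t2_space \<Rightarrow>\<^sub>C 'x::complex_normed_vector) set"
  assumes X: "uniformly_convex TYPE('x)" and K: "compact (UNIV :: 'k set)"
    and F: "function_space_over_uniform_algebra F" and f: "Delta_point F f"
  defines "\<Gamma> \<equiv> shilov_boundary (base_algebra F)"
  shows "\<exists>t. t islimpt \<Gamma> \<and> norm (apply_bcontfun f t) = 1"
proof (rule ccontr)
  assume none: "\<not> ?thesis"
  have A: "uniform_algebra (base_algebra F)"
    using F by (simp add: function_space_over_uniform_algebra_def)
  have F_sub: "subspace F"
    using F csubspace_subspace by (auto simp: function_space_over_uniform_algebra_def)
  have fF: "f \<in> F" "norm f = 1"
    using f by (auto simp: Delta_point_def)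
  have f1: "norm (apply_bcontfun f t) \<le> 1" for t
    using norm_bounded[of f t] fF by simp
  have \<Gamma>: "closed \<Gamma>"
    unfolding \<Gamma>_def by (rule shilov_boundary_least[OF A K])
  define D where "D = \<Gamma> \<inter> {t. norm (apply_bcontfun f t) = 1}"
  have "compact D"
    using compact_Int_closed[OF K closed_Int[OF \<Gamma> closed_norm_eq]] by (simp add: D_def)
  \<comment> \<open>An infinite subset of the compact set D would have a limit point in D, and this
    would be a limit point of \<Gamma>.\<close>
  have "finite D"
  proof (rule ccontr)
    assume "infinite D"
    then obtain t where "t \<in> D" "t islimpt D"
      using Heine_Borel_imp_Bolzano_Weierstrass[OF \<open>compact D\<close>] by blast
    then show False
      using none islimpt_subset[of t D \<Gamma>] by (auto simp: D_def)
  qed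
  \<comment> \<open>The points of D are isolated in \<Gamma>, so \<open>\<Gamma> - D\<close> is
    closed and f is uniformly below norm one on it.\<close>
  have "\<exists>T. open T \<and> t \<in> T \<and> T \<inter> \<Gamma> \<subseteq> {t}" if "t \<in> D" for t
  proof -
    have "\<not> t islimpt \<Gamma>"
      using none that by (auto simp: D_def)
    then show ?thesis
      unfolding islimpt_def by blast
  qed
  then obtain T where T: "\<And>t. t \<in> D \<Longrightarrow> open (T t) \<and> t \<in> T t \<and> T t \<inter> \<Gamma> \<subseteq> {t}"
    by metis
  have "\<Gamma> - D = \<Gamma> - (\<Union>t\<in>D. T t)"
    using T by blast
  then have "closed (\<Gamma> - D)"
    using T \<Gamma> by (auto intro!: closed_Diff)
  then have comp: "compact (\<Gamma> - D)"
    using compact_Int_closed[OF K] by force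
  have "norm (apply_bcontfun f t) < 1" if "t \<in> \<Gamma> - D" for t
    using f1[of t] that by (auto simp: D_def)
  then obtain r where r: "r < 1" "\<And>t. t \<in> \<Gamma> - D \<Longrightarrow> norm (apply_bcontfun f t) \<le> r"
    using norm_le_on_compact[OF comp, of 1 f] by (metis zero_less_one)
  obtain \<delta> where \<delta>: "\<delta> > 0" "\<And>x y :: 'x. norm x \<le> 1 \<Longrightarrow> norm y \<le> 1 \<Longrightarrow> norm (x - y) \<ge> 1 \<Longrightarrow>
      norm (x + y) \<le> 2 - 2 * \<delta>"
    using uniformly_convex_midpoint[OF X, of 1] by auto
  \<comment> \<open>The first entry keeps the maximum of \<open>f - g\<close> inside D; the second
    makes uniform convexity applicable there.\<close>
  define \<epsilon> where "\<epsilon> = min ((1 - r) / 2) \<delta>"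
  have \<epsilon>: "\<epsilon> > 0" "\<epsilon> < 1 - r" "\<epsilon> < 2 * \<delta>"
    using r(1) \<delta>(1) by (auto simp: \<epsilon>_def min_def)
  \<comment> \<open>Every summand is at most 2 for g in the unit ball, and one of them drops to 1
    when g is in the Delta-set; f itself gives the full \<open>2 * card D\<close>.\<close>
  define C where "C = {g. (\<Sum>t\<in>D. norm (apply_bcontfun g t + apply_bcontfun f t)) \<le> 2 * real (card D) - 1}"
  have "Delta_set F \<epsilon> f \<subseteq> C"
  proof
    fix g assume "g \<in> Delta_set F \<epsilon> f"
    then have g: "g \<in> F" "norm g \<le> 1" "norm (f - g) \<ge> 2 - \<epsilon>"
      by (auto simp: Delta_set_def)
    have g1: "norm (apply_bcontfun g t) \<le> 1" for t
      using norm_bounded[of g t] g(2) by simp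
    obtain u where u: "u \<in> \<Gamma>" "norm (apply_bcontfun (f - g) u) = norm (f - g)"
      using attains_norm_on_shilov_boundary[OF K A subspace_diff[OF F_sub fF(1) g(1)]]
      unfolding \<Gamma>_def by blast
    then have big: "norm (apply_bcontfun f u - apply_bcontfun g u) \<ge> 2 - \<epsilon>"
      using g(3) by simp
    \<comment> \<open>Off D the distance is at most \<open>r + 1\<close>, which is below
      \<open>2 - \<epsilon>\<close>.\<close>
    have uD: "u \<in> D"
    proof (rule ccontr)
      assume "u \<notin> D"
      then show False
        using r(2)[of u] u(1) g1[of u] big norm_triangle_ineq4[of "apply_bcontfun f u" "apply_bcontfun g u"] \<epsilon>(2)
        by simp
    qed
    \<comment> \<open>Uniform convexity for the values of f and - g at u: if they were at distance
      at least 1, their sum would have norm at most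
      \<open>2 - 2 * \<delta> < 2 - \<epsilon>\<close>.\<close>
    have "norm (apply_bcontfun g u + apply_bcontfun f u) \<le> 1"
      using \<delta>(2)[of "apply_bcontfun f u" "- apply_bcontfun g u"] f1[of u] g1[of u] big \<epsilon>(3)
      by (force simp: add.commute)
    moreover have "(\<Sum>t\<in>D - {u}. norm (apply_bcontfun g t + apply_bcontfun f t)) \<le> real (card (D - {u})) * 2"
    proof (rule sum_bounded_above)
      show "norm (apply_bcontfun g t + apply_bcontfun f t) \<le> 2" for t
        using norm_triangle_ineq[of "apply_bcontfun g t" "apply_bcontfun f t"] f1[of t] g1[of t] by linarith
    qed
    moreover have "real (card (D - {u})) = real (card D) - 1"
      using card.remove[OF \<open>finite D\<close> uD] by simp
    ultimately show "g \<in> C"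
      using sum.remove[OF \<open>finite D\<close> uD, of "\<lambda>t. norm (apply_bcontfun g t + apply_bcontfun f t)"]
      by (simp add: C_def)
  qed
  moreover have "convex C"
    unfolding convex_alt C_def
  proof (intro ballI allI impI, clarify)
    fix g h :: "'k \<Rightarrow>\<^sub>C 'x" and u :: real
    let ?s = "\<lambda>g. \<Sum>t\<in>D. norm (apply_bcontfun g t + apply_bcontfun f t)"
    assume le: "?s g \<le> 2 * real (card D) - 1" "?s h \<le> 2 * real (card D) - 1" and u: "0 \<le> u" "u \<le> 1"
    have "?s ((1 - u) *\<^sub>R g + u *\<^sub>R h) \<le> (\<Sum>t\<in>D. (1 - u) * norm (apply_bcontfun g t + apply_bcontfun f t)
        + u * norm (apply_bcontfun h t + apply_bcontfun f t))"
    proof (rule sum_mono)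
      fix t
      have "apply_bcontfun ((1 - u) *\<^sub>R g + u *\<^sub>R h) t + apply_bcontfun f t
          = (1 - u) *\<^sub>R (apply_bcontfun g t + apply_bcontfun f t) + u *\<^sub>R (apply_bcontfun h t + apply_bcontfun f t)"
        by (simp add: algebra_simps)
      also have "norm \<dots> \<le> norm ((1 - u) *\<^sub>R (apply_bcontfun g t + apply_bcontfun f t)) + norm (u *\<^sub>R (apply_bcontfun h t + apply_bcontfun f t))"
        by (rule norm_triangle_ineq)
      finally show "norm (apply_bcontfun ((1 - u) *\<^sub>R g + u *\<^sub>R h) t + apply_bcontfun f t)
          \<le> (1 - u) * norm (apply_bcontfun g t + apply_bcontfun f t) + u * norm (apply_bcontfun h t + apply_bcontfun f t)"
        using u by simp
    qed
    also have "\<dots> = (1 - u) * ?s g + u * ?s h"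
      by (simp add: sum.distrib sum_distrib_left)
    also have "\<dots> \<le> 2 * real (card D) - 1"
      using le u by (intro convex_bound_le) auto
    finally show "?s ((1 - u) *\<^sub>R g + u *\<^sub>R h) \<le> 2 * real (card D) - 1" .
  qed
  moreover have "closed C"
    unfolding C_def by (intro closed_Collect_le continuous_intros
        bounded_linear.continuous_on[OF bounded_linear_apply_bcontfun])
  ultimately have "closure (convex hull (Delta_set F \<epsilon> f)) \<subseteq> C"
    by (simp add: closure_minimal hull_minimal)
  then have "f \<in> C"
    using f \<epsilon>(1) by (auto simp: Delta_point_def)
  moreover have "norm (apply_bcontfun f t + apply_bcontfun f t) = 2" if "t \<in> D" for t
    using that by (simp add: D_def scaleR_2[symmetric])
  ultimately show False
    by (simp add: C_def)
qed

section \<open>From norm-attaining limit points to Daugavet points\<close>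

lemma limit_point_imp_Daugavet_point:
  fixes F :: "('k::t2_space \<Rightarrow>\<^sub>C 'x::complex_normed_vector) set"
  assumes K: "compact (UNIV :: 'k set)" and F: "function_space_over_uniform_algebra F"
    and f: "f \<in> F" "norm f = 1"
    and t0: "t0 islimpt shilov_boundary (base_algebra F)" "norm (apply_bcontfun f t0) = 1"
  shows "Daugavet_point F f"
proof -
  have A: "uniform_algebra (base_algebra F)"
    using F by (simp add: function_space_over_uniform_algebra_def)
  have F_sub: "subspace F"
    using F csubspace_subspace by (auto simp: function_space_over_uniform_algebra_def)
  have F_mult: "fmult \<phi> h \<in> F" if "\<phi> \<in> base_algebra F" "h \<in> F" for \<phi> h
    using F that by (auto simp: function_space_over_uniform_algebra_def)
  have "closed F"
    using F by (simp add: function_space_over_uniform_algebra_def)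
  have f1: "norm (apply_bcontfun f t) \<le> 1" for t
    using norm_bounded[of f t] f by simp
  have "y \<in> closure (convex hull (Delta_set F \<epsilon> f))" if "\<epsilon> > 0" and y: "y \<in> F" "norm y \<le> 1" for \<epsilon> y
    unfolding closure_approachable
  proof (intro allI impI)
    fix e :: real assume "e > 0"
    \<comment> \<open>The bound \<epsilon> / 4 serves the distance to f, e / 12 the distance of the
      average to y, and 1 gives \<open>1 + \<eta> <= 2\<close>.\<close>
    define \<eta> where "\<eta> = min 1 (min (\<epsilon> / 4) (e / 12))"
    have "0 < \<eta>" "\<eta> \<le> 1" "\<eta> \<le> \<epsilon> / 4" "\<eta> \<le> e / 12"
      unfolding \<eta>_def using \<open>\<epsilon> > 0\<close> \<open>e > 0\<close>
      by (simp_all only: min_less_iff_conj min.coboundedI1 min.coboundedI2 order_refl)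
        simp
    then have \<eta>: "0 < \<eta>" "\<eta> \<le> 1" "\<eta> \<le> \<epsilon> / 4" "3 * \<eta> \<le> e / 4"
      by simp_all
    define c where "c = 1 / (1 + \<eta>)"
    have c: "0 \<le> c" "c \<le> 1" "1 - \<eta> \<le> c" "c * (1 + \<eta>) = 1"
      using \<eta>(1) by (simp_all add: c_def field_simps)
    obtain n :: nat where n: "real n > 16 / e"
      using reals_Archimedean2 by blast
    have "real n > 0"
      using n \<open>e > 0\<close> by (intro order.strict_trans[OF _ n]) simp
    then have n0: "real n > 0" "4 / real n < e / 4"
      using n \<open>e > 0\<close> by (simp_all add: field_simps)
    define W where "W = {t. norm (apply_bcontfun f t) > 1 - \<epsilon> / 4}"
    have "open W"
      unfolding W_def by (intro open_Collect_less continuous_intros continuous_on_apply_bcontfun)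
    moreover have "t0 \<in> W"
      using t0(2) \<open>\<epsilon> > 0\<close> by (simp add: W_def)
    ultimately obtain P where P: "P \<subseteq> shilov_boundary (base_algebra F) \<inter> W" "finite P" "card P = n"
      using islimpt_infinite_Int_open[OF t0(1)] infinite_arbitrarily_large by metis
    obtain V where V: "\<And>p. p \<in> P \<Longrightarrow> open (V p)" "\<And>p. p \<in> P \<Longrightarrow> p \<in> V p"
        "\<And>p q. p \<in> P \<Longrightarrow> q \<in> P \<Longrightarrow> p \<noteq> q \<Longrightarrow> V p \<inter> V q = {}"
      using disjoint_open_neighbourhoods[OF P(2)] by blast
    \<comment> \<open>Bundling all properties allows \<phi> and s to be chosen simultaneously for
      all p.\<close>
    define peak where "peak p \<phi> s \<longleftrightarrow> \<phi> \<in> base_algebra F \<and> s \<in> V p \<inter> W \<and> apply_bcontfun \<phi> s = 1 \<and>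
        (\<forall>t. cmod (apply_bcontfun \<phi> t) + cmod (1 - apply_bcontfun \<phi> t) \<le> 1 + \<eta>) \<and>
        (\<forall>t. t \<notin> V p \<inter> W \<longrightarrow> cmod (apply_bcontfun \<phi> t) \<le> \<eta>)" for p \<phi> s
    have "\<exists>\<phi> s. peak p \<phi> s" if "p \<in> P" for p
      unfolding peak_def
      by (rule shilov_peak[OF A K, of "V p \<inter> W" p \<eta>]) (use that V P(1) \<open>open W\<close> \<eta>(1) in \<open>blast+\<close>)
    then obtain \<phi> s where "peak p (\<phi> p) (s p)" if "p \<in> P" for p
      by metis
    then have \<phi>: "\<And>p. p \<in> P \<Longrightarrow> \<phi> p \<in> base_algebra F"
        "\<And>p. p \<in> P \<Longrightarrow> s p \<in> V p \<inter> W" "\<And>p. p \<in> P \<Longrightarrow> apply_bcontfun (\<phi> p) (s p) = 1"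
        "\<And>p t. p \<in> P \<Longrightarrow> cmod (apply_bcontfun (\<phi> p) t) + cmod (1 - apply_bcontfun (\<phi> p) t) \<le> 1 + \<eta>"
        "\<And>p t. p \<in> P \<Longrightarrow> t \<notin> V p \<inter> W \<Longrightarrow> cmod (apply_bcontfun (\<phi> p) t) \<le> \<eta>"
      unfolding peak_def by simp_all
    \<comment> \<open>At the peak y is replaced by - f, while y is nearly kept off
      \<open>V p \<inter> W\<close>. The factor c rescales the norm bound 1 + \<eta> to 1.\<close>
    define g where "g p = c *\<^sub>R (y - fmult (\<phi> p) (y + f))" for p
    have g: "g p \<in> Delta_set F \<epsilon> f" if p: "p \<in> P" for p
      unfolding Delta_set_def
    proof (intro CollectI conjI)
      have one: "1 *\<^sub>C x = x" for x :: 'x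
        using scaleC_of_real[of 1 x] by simp
      show "g p \<in> F"
        unfolding g_def by (intro subspace_scale subspace_diff subspace_add F_sub F_mult \<phi> p y f)
      show "norm (g p) \<le> 1"
      proof (rule norm_bound)
        fix t
        have y1: "norm (apply_bcontfun y t) \<le> 1"
          using norm_bounded[of y t] y(2) by simp
        have "apply_bcontfun (y - fmult (\<phi> p) (y + f)) t
            = (1 - apply_bcontfun (\<phi> p) t) *\<^sub>C apply_bcontfun y t - apply_bcontfun (\<phi> p) t *\<^sub>C apply_bcontfun f t"
          by (simp add: scaleC_add_right one bounded_bilinear.diff_left[OF bounded_bilinear_scaleC])
        also have "norm \<dots> \<le> cmod (1 - apply_bcontfun (\<phi> p) t) * norm (apply_bcontfun y t)
            + cmod (apply_bcontfun (\<phi> p) t) * norm (apply_bcontfun f t)"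
          unfolding norm_scaleC[symmetric] by (rule norm_triangle_ineq4)
        also have "\<dots> \<le> cmod (1 - apply_bcontfun (\<phi> p) t) * 1 + cmod (apply_bcontfun (\<phi> p) t) * 1"
          using y1 f1 by (intro add_mono mult_left_mono) auto
        also have "\<dots> \<le> 1 + \<eta>"
          using \<phi>(4)[OF p, of t] by simp
        finally have "c * norm (apply_bcontfun (y - fmult (\<phi> p) (y + f)) t) \<le> c * (1 + \<eta>)"
          using c(1) by (rule mult_left_mono)
        then show "norm (apply_bcontfun (g p) t) \<le> 1"
          using c by (simp add: g_def)
      qed
      \<comment> \<open>Since \<phi> p is 1 at s p, the contribution of y cancels and g p equals - c
        times f there.\<close>
      have eq: "apply_bcontfun (f - g p) (s p) = (1 + c) *\<^sub>R apply_bcontfun f (s p)"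
        by (simp add: g_def \<phi> p one algebra_simps)
      have "(1 - \<eta>) * norm (apply_bcontfun f (s p)) \<le> c * norm (apply_bcontfun f (s p))"
        using c(3) by (intro mult_right_mono) auto
      moreover have "\<eta> * norm (apply_bcontfun f (s p)) \<le> \<eta> * 1"
        using f1 \<eta>(1) by (intro mult_left_mono) auto
      moreover have "norm (apply_bcontfun f (s p)) > 1 - \<epsilon> / 4"
        using \<phi>(2)[OF p] by (simp add: W_def)
      ultimately have "2 - \<epsilon> \<le> (1 + c) * norm (apply_bcontfun f (s p))"
        using \<eta>(3) \<open>\<epsilon> > 0\<close> unfolding distrib_right left_diff_distrib by linarith
      also have "\<dots> = norm (apply_bcontfun (f - g p) (s p))"
        unfolding eq using c(1) by simp
      finally have "2 - \<epsilon> \<le> norm (apply_bcontfun (f - g p) (s p))" .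
      then show "2 - \<epsilon> \<le> norm (f - g p)"
        using norm_bounded[of "f - g p" "s p"] by simp
    qed
    define z where "z = (\<Sum>p\<in>P. (1 / real n) *\<^sub>R g p)"
    have "z \<in> convex hull (Delta_set F \<epsilon> f)"
      unfolding z_def using P n0 g
      by (intro convex_sum[OF P(2) convex_convex_hull]) (simp_all add: hull_inc)
    moreover have "dist z y < e"
    proof -
      define \<Phi> where "\<Phi> t = (\<Sum>p\<in>P. apply_bcontfun (\<phi> p) t)" for t
      \<comment> \<open>By disjointness at most one V p contains t. That term is at most 1 + \<eta>,
        the others at most \<eta> each, so after division by n only a small amount remains.\<close>
      have \<Phi>: "cmod (\<Phi> t) \<le> (1 + \<eta>) + real n * \<eta>" for t
      proof -
        have le1: "cmod (apply_bcontfun (\<phi> p) t) \<le> 1 + \<eta>" if "p \<in> P" for p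
          using \<phi>(4)[OF that, of t] norm_ge_zero[of "1 - apply_bcontfun (\<phi> p) t"] by linarith
        show ?thesis
        proof (cases "\<exists>p\<in>P. t \<in> V p")
          case True
          then obtain p where p: "p \<in> P" "t \<in> V p" by blast
          have "cmod (apply_bcontfun (\<phi> q) t) \<le> \<eta>" if "q \<in> P - {p}" for q
            using \<phi>(5)[of q t] V(3)[of p q] p that by blast
          then have "(\<Sum>q\<in>P - {p}. cmod (apply_bcontfun (\<phi> q) t)) \<le> real (card (P - {p})) * \<eta>"
            by (rule sum_bounded_above)
          also have "\<dots> \<le> real n * \<eta>"
            using P \<eta>(1) by (intro mult_right_mono) (auto simp: card_Diff1_le)
          finally show ?thesis
            unfolding \<Phi>_def using le1[OF p(1)] norm_sum[of "\<lambda>p. apply_bcontfun (\<phi> p) t" P]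
              sum.remove[OF P(2) p(1), of "\<lambda>p. cmod (apply_bcontfun (\<phi> p) t)"] by linarith
        next
          case False
          then have "(\<Sum>q\<in>P. cmod (apply_bcontfun (\<phi> q) t)) \<le> real n * \<eta>"
            unfolding P(3)[symmetric] by (intro sum_bounded_above \<phi>(5)) auto
          then show ?thesis
            unfolding \<Phi>_def using norm_sum[of "\<lambda>p. apply_bcontfun (\<phi> p) t" P] \<eta>(1) by linarith
        qed
      qed
      \<comment> \<open>The first \<eta> accounts for the rescaling by c; the rest is \<Phi> divided
        by n, applied to y + f, which has norm at most 2.\<close>
      have "norm (z - y) \<le> \<eta> + 2 * ((1 + \<eta>) / real n + \<eta>)"
      proof (rule norm_bound)
        fix t
        let ?v = "apply_bcontfun y t + apply_bcontfun f t"
        have sumC: "(\<Sum>p\<in>Q. apply_bcontfun (\<phi> p) t *\<^sub>C x) = (\<Sum>p\<in>Q. apply_bcontfun (\<phi> p) t) *\<^sub>C x" for Q and x :: 'x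
          using bounded_bilinear.sum_left[OF bounded_bilinear_scaleC, of "\<lambda>p. apply_bcontfun (\<phi> p) t" Q x] by simp
        have "apply_bcontfun z t = (\<Sum>p\<in>P. (c / real n) *\<^sub>R apply_bcontfun y t
            - (c / real n) *\<^sub>R apply_bcontfun (\<phi> p) t *\<^sub>C ?v)"
          by (simp add: z_def g_def apply_bcontfun_sum scaleR_diff_right)
        also have "\<dots> = real n *\<^sub>R (c / real n) *\<^sub>R apply_bcontfun y t
            - (\<Sum>p\<in>P. (c / real n) *\<^sub>R apply_bcontfun (\<phi> p) t *\<^sub>C ?v)"
          by (simp only: sum_subtractf sum_constant_scaleR P(3))
        also have "\<dots> = c *\<^sub>R apply_bcontfun y t - (c / real n) *\<^sub>R \<Phi> t *\<^sub>C ?v"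
          unfolding scaleR_sum_right[symmetric] sumC \<Phi>_def using n0(1) by simp
        finally have "apply_bcontfun (z - y) t = - ((1 - c) *\<^sub>R apply_bcontfun y t) - (c / real n) *\<^sub>R \<Phi> t *\<^sub>C ?v"
          by (simp add: algebra_simps)
        then have "norm (apply_bcontfun (z - y) t) \<le> (1 - c) * norm (apply_bcontfun y t) + c / real n * (cmod (\<Phi> t) * norm ?v)"
          using norm_triangle_ineq4[of "- ((1 - c) *\<^sub>R apply_bcontfun y t)" "(c / real n) *\<^sub>R \<Phi> t *\<^sub>C ?v"] c(1,2)
          by (simp add: norm_scaleC)
        also have "\<dots> \<le> \<eta> * 1 + 1 / real n * (((1 + \<eta>) + real n * \<eta>) * 2)"
        proof (intro add_mono mult_mono)
          show "norm (apply_bcontfun y t) \<le> 1"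
            using norm_bounded[of y t] y(2) by simp
          then show "norm ?v \<le> 2"
            using norm_triangle_ineq[of "apply_bcontfun y t" "apply_bcontfun f t"] f1[of t] by simp
          show "c / real n \<le> 1 / real n"
            using c(2) by (simp add: divide_right_mono)
        qed (use c \<eta> \<Phi> in auto)
        also have "\<dots> = \<eta> + 2 * ((1 + \<eta>) / real n + \<eta>)"
          using n0(1) by (simp add: field_simps)
        finally show "norm (apply_bcontfun (z - y) t) \<le> \<eta> + 2 * ((1 + \<eta>) / real n + \<eta>)" .
      qed
      also have "\<dots> \<le> 3 * \<eta> + 4 / real n"
        using \<eta>(2) n0(1) by (simp add: field_simps)
      also have "\<dots> < e"
        using \<eta>(4) n0(2) \<open>e > 0\<close> by linarith
      finally show ?thesis
        by (simp add: dist_norm)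
    qed
    ultimately show "\<exists>z\<in>convex hull (Delta_set F \<epsilon> f). dist z y < e"
      by blast
  qed
  moreover have "closure (convex hull (Delta_set F \<epsilon> f)) \<subseteq> {y \<in> F. norm y \<le> 1}" for \<epsilon>
  proof (rule closure_minimal)
    have ball: "{y \<in> F. norm y \<le> 1} = F \<inter> cball 0 1"
      by (auto simp: dist_norm)
    show "closed {y \<in> F. norm y \<le> 1}"
      unfolding ball using \<open>closed F\<close> by (intro closed_Int) auto
    show "convex hull (Delta_set F \<epsilon> f) \<subseteq> {y \<in> F. norm y \<le> 1}"
    proof (rule hull_minimal)
      show "convex {y \<in> F. norm y \<le> 1}"
        unfolding ball using subspace_imp_convex[OF F_sub] by (intro convex_Int) auto
    qed (auto simp: Delta_set_def)
  qed
  ultimately show ?thesis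
    unfolding Daugavet_point_def using f by auto
qed

theorem theorem5p4:
  fixes F :: "('k::t2_space \<Rightarrow>\<^sub>C 'x::complex_banach) set"
    and A :: "('k \<Rightarrow>\<^sub>C complex) set"
    and \<Gamma> :: "'k set"
    and f :: "'k \<Rightarrow>\<^sub>C 'x"
  assumes X_nontrivial: "\<exists>x :: 'x. x \<noteq> 0"
    and X_uniformly_convex: "uniformly_convex TYPE('x)"
    and K_compact: "compact (UNIV :: 'k set)"
    and F: "function_space_over_uniform_algebra F"
    and A: "A = base_algebra F"
    and \<Gamma>: "\<Gamma> = shilov_boundary A"
    and f: "f \<in> F" "norm f = 1"
  shows "(Daugavet_point F f \<longrightarrow> Delta_point F f) \<and>
    (Delta_point F f \<longrightarrow> (\<exists>t0. t0 islimpt \<Gamma> \<and> norm f = norm (apply_bcontfun f t0))) \<and>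
    (tensors A \<subseteq> F \<longrightarrow>
       (Daugavet_point F f \<longleftrightarrow> Delta_point F f) \<and>
       (Delta_point F f \<longleftrightarrow> (\<exists>t0. t0 islimpt \<Gamma> \<and> norm f = norm (apply_bcontfun f t0))))"
proof -
  have "\<exists>t0. t0 islimpt \<Gamma> \<and> norm f = norm (apply_bcontfun f t0)" if "Delta_point F f"
    using Delta_point_imp_limit_point[OF X_uniformly_convex K_compact F that] f(2) by (auto simp: A \<Gamma>)
  moreover have "Daugavet_point F f" if "t0 islimpt \<Gamma>" "norm f = norm (apply_bcontfun f t0)" for t0
    using limit_point_imp_Daugavet_point[OF K_compact F f] that f(2) by (auto simp: A \<Gamma>)
  ultimately show ?thesis
    using Daugavet_point_imp_Delta_point by blast
qed

end
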